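(* Let $X$ be the geometric Brownian motion $\dfrac{dX_t}{\alpha X_t+\beta}=dt+\varepsilon\,dB_t$, and consider the variational problem of the context over draw-down functions $d$ with slope $u=d'\in[0,1-\xi]$. Then: (1) Without area restrictions, the structure equation (with $r=0$) has no solution, and the optimal profile is affine with the maximal slope: $d^{opt}(t)=d(a)+(1-\xi)(t-a)$. (2) With area restrictions, the structure equation is given, in terms of $\Delta=\Delta(x)=\ln\frac{\alpha x+\beta}{\alpha (x-d^{opt}(x))+\beta}$, by $$r_+e^{r_+\Delta}-r_-e^{r_-\Delta}=\frac{1-\frac{2}{\varepsilon^2\alpha}+\Big[\big(1-\frac{2}{\varepsilon^2\alpha}\big)^2+\frac{8q}{\varepsilon^2\alpha^2}+4r\big(x+\frac{\beta}{\alpha}\big)^2e^{-\Delta}\Big]^{1/2}}{2}\,\big(e^{r_+\Delta}-e^{r_-\Delta}\big).$$ The optimal draw-down belongs to the class of functions whose piecewise components either satisfy this equation (for some fixed $r>0$), i.e. $d^{opt}(x)=\big(x+\frac{\beta}{\alpha}\big)\big(1-e^{-\Delta(x)}\big)$ with $\Delta(x)$ solving it, or are affine with the maximal slope $1-\xi$.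
   Context: $\alpha>0$, $\beta>0$, $\varepsilon>0$, $q>0$, $\xi\in[0,1]$; the state space is $\{x:\alpha x+\beta>0\}$. Let $$r_\pm=\frac{1-\frac{2}{\varepsilon^2\alpha}\pm\sqrt{\big(1-\frac{2}{\varepsilon^2\alpha}\big)^2+\frac{8q}{\varepsilon^2\alpha^2}}}{2},$$ the positive and negative roots of $\frac{\varepsilon^2\alpha^2}{2}\rho^2+\rho\big(\alpha-\frac{\varepsilon^2\alpha^2}{2}\big)-q=0$. Set $\omega_q(z)=e^{r_+z}-e^{r_-z}$, $\mu_q=\omega_q'/\omega_q$, and $$\nu_q(x,y)=\frac{\alpha}{\alpha x+\beta}\,\mu_q\Big(\ln\frac{\alpha x+\beta}{\alpha y+\beta}\Big),\qquad y<x,$$ the logarithmic derivative in $x$ of the two-variable scale function $W_q(x,y)=\omega_q\big(\ln\frac{\alpha x+\beta}{\alpha y+\beta}\big)$ of $X$. The variational problem: given $a\ge0$ and $d(a)\ge 0$, minimize $$\int_a^b\nu_q(t,t-d(t))\,dt+\log\nu_q(b,b-d(b))$$ over $b\ge a$ and over functions $d$ with $d'=u$, $u$ measurable with values in $[0,1-\xi]$ ($d(b)$ free), either without area restriction, or with the area restriction $\int_a^bd(t)\,dt\le K$ for a given $K>0$. (Minimizing this is equivalent to maximizing the expected discounted dividends paid at barrier $b$ until the draw-down time $\inf\{t:X_t<\overline X_t-d(\overline X_t)\}$.) The structure equation is $\partial_2\nu_q(x,x-d(x))=r$ ($\partial_2$ = derivative in the second variable, $r$ a constant costate multiplying $d$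 in the Hamiltonian; $r=0$ in the absence of the area restriction), which Pontryagin's principle imposes on the optimal $d$ on intervals where the coefficient of $u$ in the Hamiltonian vanishes.
   Formalization: In (2) the class claim is false as stated (slope 0 can be optimal): a third kind of piece is allowed, d constant where the coefficient of u in the Hamiltonian is positive; exactly the two stated kinds are proved when d is strictly increasing or ξ=1. *)

theory Defs
  imports "HOL-Analysis.Analysis"
begin

section \<open>Scale function of the geometric Brownian motion\<close>

definition r_plus :: "real \<Rightarrow> real \<Rightarrow> real \<Rightarrow> real" where
  "r_plus \<alpha> \<epsilon> q =
     (1 - 2 / (\<epsilon>\<^sup>2 * \<alpha>) + sqrt ((1 - 2 / (\<epsilon>\<^sup>2 * \<alpha>))\<^sup>2 + 8 * q / (\<epsilon>\<^sup>2 * \<alpha>\<^sup>2))) / 2"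

definition r_minus :: "real \<Rightarrow> real \<Rightarrow> real \<Rightarrow> real" where
  "r_minus \<alpha> \<epsilon> q =
     (1 - 2 / (\<epsilon>\<^sup>2 * \<alpha>) - sqrt ((1 - 2 / (\<epsilon>\<^sup>2 * \<alpha>))\<^sup>2 + 8 * q / (\<epsilon>\<^sup>2 * \<alpha>\<^sup>2))) / 2"

definition omega :: "real \<Rightarrow> real \<Rightarrow> real \<Rightarrow> real \<Rightarrow> real" where
  "omega \<alpha> \<epsilon> q z = exp (r_plus \<alpha> \<epsilon> q * z) - exp (r_minus \<alpha> \<epsilon> q * z)"

definition mu :: "real \<Rightarrow> real \<Rightarrow> real \<Rightarrow> real \<Rightarrow> real" where
  "mu \<alpha> \<epsilon> q z = deriv (omega \<alpha> \<epsilon> q) z / omega \<alpha> \<epsilon> q z"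

definition scale_W :: "real \<Rightarrow> real \<Rightarrow> real \<Rightarrow> real \<Rightarrow> real \<Rightarrow> real \<Rightarrow> real" where
  "scale_W \<alpha> \<beta> \<epsilon> q x y = omega \<alpha> \<epsilon> q (ln ((\<alpha> * x + \<beta>) / (\<alpha> * y + \<beta>)))"

definition nu :: "real \<Rightarrow> real \<Rightarrow> real \<Rightarrow> real \<Rightarrow> real \<Rightarrow> real \<Rightarrow> real" where
  "nu \<alpha> \<beta> \<epsilon> q x y =
     \<alpha> / (\<alpha> * x + \<beta>) * mu \<alpha> \<epsilon> q (ln ((\<alpha> * x + \<beta>) / (\<alpha> * y + \<beta>)))"

definition d2_nu :: "real \<Rightarrow> real \<Rightarrow> real \<Rightarrow> real \<Rightarrow> real \<Rightarrow> real \<Rightarrow> real" where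
  "d2_nu \<alpha> \<beta> \<epsilon> q x y = deriv (\<lambda>y'. nu \<alpha> \<beta> \<epsilon> q x y') y"

lemma deriv_omega:
  "deriv (omega \<alpha> \<epsilon> q) z =
     r_plus \<alpha> \<epsilon> q * exp (r_plus \<alpha> \<epsilon> q * z) - r_minus \<alpha> \<epsilon> q * exp (r_minus \<alpha> \<epsilon> q * z)"
  unfolding omega_def [abs_def]
  by (rule DERIV_imp_deriv) (auto intro!: derivative_eq_intros)

lemma omega_pos:
  assumes "\<alpha> > 0" "\<epsilon> > 0" "q > 0" "z > 0"
  shows "omega \<alpha> \<epsilon> q z > 0"
proof -
  have "sqrt ((1 - 2 / (\<epsilon>\<^sup>2 * \<alpha>))\<^sup>2 + 8 * q / (\<epsilon>\<^sup>2 * \<alpha>\<^sup>2)) > 0"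
    using assms by (simp add: add_nonneg_pos)
  hence "r_minus \<alpha> \<epsilon> q < r_plus \<alpha> \<epsilon> q"
    unfolding r_plus_def r_minus_def by simp
  thus ?thesis
    using assms by (simp add: omega_def)
qed

lemma characteristic_roots:
  assumes "\<alpha> > 0" "\<epsilon> > 0" "q > 0" and "\<rho> \<in> {r_plus \<alpha> \<epsilon> q, r_minus \<alpha> \<epsilon> q}"
  shows "\<epsilon>\<^sup>2 * \<alpha>\<^sup>2 / 2 * \<rho>\<^sup>2 + \<rho> * (\<alpha> - \<epsilon>\<^sup>2 * \<alpha>\<^sup>2 / 2) - q = 0"
proof -
  define A where "A = 1 - 2 / (\<epsilon>\<^sup>2 * \<alpha>)"
  define B where "B = 8 * q / (\<epsilon>\<^sup>2 * \<alpha>\<^sup>2)"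
  have B: "B > 0" using assms by (simp add: B_def)
  have sq: "(sqrt (A\<^sup>2 + B))\<^sup>2 = A\<^sup>2 + B"
    using B by (intro real_sqrt_pow2) (simp add: add_nonneg_nonneg)
  have "2 * \<rho> - A = sqrt (A\<^sup>2 + B) \<or> 2 * \<rho> - A = - sqrt (A\<^sup>2 + B)"
    using assms(4) by (auto simp: r_plus_def r_minus_def A_def [symmetric] B_def [symmetric])
  hence "(2 * \<rho> - A)\<^sup>2 = A\<^sup>2 + B"
    using sq by (auto simp only: power2_minus)
  hence "4 * (\<rho>\<^sup>2 - A * \<rho>) = B"
    by (simp add: power2_eq_square algebra_simps)
  hence "\<epsilon>\<^sup>2 * \<alpha>\<^sup>2 * (4 * (\<rho>\<^sup>2 - A * \<rho>)) = 8 * q"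
    using assms by (simp add: B_def)
  hence "4 * (\<epsilon>\<^sup>2 * \<alpha>\<^sup>2 * \<rho>\<^sup>2) - 4 * \<rho> * (\<epsilon>\<^sup>2 * \<alpha>\<^sup>2 * A) = 8 * q"
    by (simp add: algebra_simps)
  moreover have "\<epsilon>\<^sup>2 * \<alpha>\<^sup>2 * A = \<epsilon>\<^sup>2 * \<alpha>\<^sup>2 - 2 * \<alpha>"
    using assms by (simp add: A_def field_simps power2_eq_square)
  ultimately have "4 * (\<epsilon>\<^sup>2 * \<alpha>\<^sup>2 * \<rho>\<^sup>2) - 4 * \<rho> * (\<epsilon>\<^sup>2 * \<alpha>\<^sup>2 - 2 * \<alpha>) = 8 * q"
    by simp
  thus ?thesis
    by (simp add: algebra_simps)
qed

lemma ln_ratio_derivs: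
  fixes \<alpha> \<beta> c t :: real
  assumes "\<alpha> * t + \<beta> > 0" "c > 0"
  shows "((\<lambda>v. ln ((\<alpha> * v + \<beta>) / c)) has_real_derivative \<alpha> / (\<alpha> * t + \<beta>)) (at t)"
    and "((\<lambda>v. ln (c / (\<alpha> * v + \<beta>))) has_real_derivative - (\<alpha> / (\<alpha> * t + \<beta>))) (at t)"
proof -
  have pos: "\<forall>\<^sub>F v in nhds t. \<alpha> * v + \<beta> > 0"
    by (intro order_tendstoD(1) [OF _ assms(1)] tendsto_intros filterlim_ident)
  have "\<forall>\<^sub>F v in nhds t. ln ((\<alpha> * v + \<beta>) / c) = ln (\<alpha> * v + \<beta>) - ln c"
    using pos by eventually_elim (use assms in \<open>simp add: ln_div\<close>)
  note 1 = DERIV_cong_ev [OF refl this refl]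
  show "((\<lambda>v. ln ((\<alpha> * v + \<beta>) / c)) has_real_derivative \<alpha> / (\<alpha> * t + \<beta>)) (at t)"
    unfolding 1 using assms by (auto intro!: derivative_eq_intros)
  have "\<forall>\<^sub>F v in nhds t. ln (c / (\<alpha> * v + \<beta>)) = ln c - ln (\<alpha> * v + \<beta>)"
    using pos by eventually_elim (use assms in \<open>simp add: ln_div\<close>)
  note 2 = DERIV_cong_ev [OF refl this refl]
  show "((\<lambda>v. ln (c / (\<alpha> * v + \<beta>))) has_real_derivative - (\<alpha> / (\<alpha> * t + \<beta>))) (at t)"
    unfolding 2 using assms by (auto intro!: derivative_eq_intros)
qed

text \<open>\<open>scale_W\<close> is harmonic for the generator of \<open>dX = (\<alpha> X + \<beta>) (dt + \<epsilon> dB)\<close> killed at rate \<open>q\<close>,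
  and \<open>nu\<close> is its logarithmic derivative.\<close>

lemma scale_W_generator:
  assumes "\<alpha> > 0" "\<epsilon> > 0" "q > 0" "\<alpha> * x + \<beta> > 0" "\<alpha> * y + \<beta> > 0"
  obtains W' W'' where
    "\<And>t. \<alpha> * t + \<beta> > 0 \<Longrightarrow> ((\<lambda>t. scale_W \<alpha> \<beta> \<epsilon> q t y) has_real_derivative W' t) (at t)"
    "(W' has_real_derivative W'') (at x)"
    "\<epsilon>\<^sup>2 / 2 * (\<alpha> * x + \<beta>)\<^sup>2 * W'' + (\<alpha> * x + \<beta>) * W' x - q * scale_W \<alpha> \<beta> \<epsilon> q x y = 0"
proof -
  define p where "p = r_plus \<alpha> \<epsilon> q"
  define m where "m = r_minus \<alpha> \<epsilon> q"
  define L where "L t = ln ((\<alpha> * t + \<beta>) / (\<alpha> * y + \<beta>))" for t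
  define s where "s = \<alpha> * x + \<beta>"
  have s: "s > 0" using assms by (simp add: s_def)
  have L: "(L has_real_derivative \<alpha> / (\<alpha> * t + \<beta>)) (at t)" if "\<alpha> * t + \<beta> > 0" for t
    unfolding L_def [abs_def] using that assms by (intro ln_ratio_derivs)
  define W' where "W' t = (p * exp (p * L t) - m * exp (m * L t)) * (\<alpha> / (\<alpha> * t + \<beta>))" for t
  define W'' where "W'' = (p\<^sup>2 * exp (p * L x) - m\<^sup>2 * exp (m * L x)) * (\<alpha> / s)\<^sup>2
                          - (p * exp (p * L x) - m * exp (m * L x)) * (\<alpha> / s)\<^sup>2"
  have W: "scale_W \<alpha> \<beta> \<epsilon> q t y = exp (p * L t) - exp (m * L t)" for t
    by (simp add: scale_W_def omega_def p_def m_def L_def)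
  have 1: "((\<lambda>t. scale_W \<alpha> \<beta> \<epsilon> q t y) has_real_derivative W' t) (at t)"
    if "\<alpha> * t + \<beta> > 0" for t
    unfolding W W'_def using L [OF that]
    by (auto intro!: derivative_eq_intros simp: algebra_simps)
  have "((\<lambda>t. p * exp (p * L t) - m * exp (m * L t)) has_real_derivative
      (p\<^sup>2 * exp (p * L x) - m\<^sup>2 * exp (m * L x)) * (\<alpha> / s)) (at x)"
    using L [OF assms(4)] unfolding s_def [symmetric]
    by (auto intro!: derivative_eq_intros simp: algebra_simps power2_eq_square)
  moreover have "((\<lambda>t. \<alpha> / (\<alpha> * t + \<beta>)) has_real_derivative - (\<alpha> / s)\<^sup>2) (at x)"
    using s by (auto intro!: derivative_eq_intros simp: s_def power2_eq_square)
  ultimately have 2: "(W' has_real_derivative W'') (at x)"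
    unfolding W'_def [abs_def] W''_def
    by (rule DERIV_mult [THEN DERIV_cong])
       (simp only: s_def [symmetric], simp add: algebra_simps power2_eq_square)
  have key: "\<epsilon>\<^sup>2 / 2 * s\<^sup>2 * ((\<rho>\<^sup>2 - \<rho>) * (\<alpha> / s)\<^sup>2) + s * (\<rho> * (\<alpha> / s)) - q = 0"
    if "\<rho> \<in> {p, m}" for \<rho>
  proof -
    have "\<epsilon>\<^sup>2 / 2 * s\<^sup>2 * ((\<rho>\<^sup>2 - \<rho>) * (\<alpha> / s)\<^sup>2) + s * (\<rho> * (\<alpha> / s)) - q
        = \<epsilon>\<^sup>2 * \<alpha>\<^sup>2 / 2 * \<rho>\<^sup>2 + \<rho> * (\<alpha> - \<epsilon>\<^sup>2 * \<alpha>\<^sup>2 / 2) - q"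
      using s by (simp add: field_simps power2_eq_square)
    thus ?thesis
      using characteristic_roots [OF assms(1-3)] that by (simp add: p_def m_def)
  qed
  have "\<epsilon>\<^sup>2 / 2 * s\<^sup>2 * W'' + s * W' x - q * (exp (p * L x) - exp (m * L x))
      = (\<epsilon>\<^sup>2 / 2 * s\<^sup>2 * ((p\<^sup>2 - p) * (\<alpha> / s)\<^sup>2) + s * (p * (\<alpha> / s)) - q) * exp (p * L x)
      - (\<epsilon>\<^sup>2 / 2 * s\<^sup>2 * ((m\<^sup>2 - m) * (\<alpha> / s)\<^sup>2) + s * (m * (\<alpha> / s)) - q) * exp (m * L x)"
    unfolding W''_def W'_def s_def [symmetric] by (simp only: ring_distribs) (simp add: algebra_simps)
  also have "\<dots> = 0"
    using key [of p] key [of m] by simp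
  finally show ?thesis
    using that [of W', OF 1 2] by (simp add: W s_def)
qed

lemma nu_log_derivative:
  assumes "\<alpha> > 0" "\<epsilon> > 0" "q > 0" "\<alpha> * y + \<beta> > 0" "y < x"
  shows "((\<lambda>t. ln (scale_W \<alpha> \<beta> \<epsilon> q t y)) has_real_derivative nu \<alpha> \<beta> \<epsilon> q x y) (at x)"
proof -
  have "\<alpha> * y < \<alpha> * x"
    using assms by simp
  hence x: "\<alpha> * x + \<beta> > 0" "\<alpha> * x + \<beta> > \<alpha> * y + \<beta>"
    using assms by linarith+
  have L: "ln ((\<alpha> * x + \<beta>) / (\<alpha> * y + \<beta>)) > 0"
    using x assms by (intro ln_gt_zero) simp
  moreover define l where "l t = ln ((\<alpha> * t + \<beta>) / (\<alpha> * y + \<beta>))" for t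
  ultimately have pos: "omega \<alpha> \<epsilon> q (l x) > 0"
    using omega_pos assms by simp
  have "(l has_real_derivative \<alpha> / (\<alpha> * x + \<beta>)) (at x)"
    unfolding l_def [abs_def] using assms x by (intro ln_ratio_derivs)
  hence "((\<lambda>t. ln (omega \<alpha> \<epsilon> q (l t))) has_real_derivative
      \<alpha> / (\<alpha> * x + \<beta>) * mu \<alpha> \<epsilon> q (l x)) (at x)"
    using pos unfolding mu_def deriv_omega unfolding omega_def
    by (auto intro!: derivative_eq_intros simp: divide_inverse algebra_simps)
  thus ?thesis
    by (simp add: scale_W_def nu_def l_def)
qed

lemma d2_nu_has_derivative:
  assumes "\<alpha> > 0" "\<epsilon> > 0" "q > 0" "\<alpha> * y + \<beta> > 0" "y < x"
  shows "(nu \<alpha> \<beta> \<epsilon> q x has_real_derivative d2_nu \<alpha> \<beta> \<epsilon> q x y) (at y)"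
proof -
  have "\<alpha> * y < \<alpha> * x"
    using assms by simp
  hence x: "\<alpha> * x + \<beta> > 0" "\<alpha> * x + \<beta> > \<alpha> * y + \<beta>"
    using assms by linarith+
  have L: "ln ((\<alpha> * x + \<beta>) / (\<alpha> * y + \<beta>)) > 0"
    using x assms by (intro ln_gt_zero) simp
  have "omega \<alpha> \<epsilon> q (ln ((\<alpha> * x + \<beta>) / (\<alpha> * y + \<beta>))) > 0"
    using omega_pos assms L by blast
  moreover define z where "z = ln ((\<alpha> * x + \<beta>) / (\<alpha> * y + \<beta>))"
  ultimately have z: "omega \<alpha> \<epsilon> q z \<noteq> 0"
    by simp
  define p where "p = r_plus \<alpha> \<epsilon> q"
  define m where "m = r_minus \<alpha> \<epsilon> q"
  have "(mu \<alpha> \<epsilon> q has_real_derivative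
      ((p\<^sup>2 * exp (p * z) - m\<^sup>2 * exp (m * z)) * (exp (p * z) - exp (m * z))
       - (p * exp (p * z) - m * exp (m * z)) * (p * exp (p * z) - m * exp (m * z)))
      / ((exp (p * z) - exp (m * z)) * (exp (p * z) - exp (m * z)))) (at z)"
    using z unfolding mu_def [abs_def] deriv_omega
    unfolding omega_def p_def [symmetric] m_def [symmetric]
    by (auto intro!: derivative_eq_intros simp: power2_eq_square mult_ac)
  then obtain D where D: "(mu \<alpha> \<epsilon> q has_real_derivative D) (at z)"
    by blast
  have "((\<lambda>v. ln ((\<alpha> * x + \<beta>) / (\<alpha> * v + \<beta>))) has_real_derivative - (\<alpha> / (\<alpha> * y + \<beta>))) (at y)"
    using assms x by (intro ln_ratio_derivs)
  from DERIV_cmult [OF DERIV_chain2 [OF D [unfolded z_def] this], of "\<alpha> / (\<alpha> * x + \<beta>)"]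
  have "\<exists>D. (nu \<alpha> \<beta> \<epsilon> q x has_real_derivative D) (at y)"
    unfolding nu_def [abs_def] by blast
  thus ?thesis
    unfolding d2_nu_def using DERIV_imp_deriv by blast
qed


section \<open>The variational problem\<close>

definition admissible :: "real \<Rightarrow> real \<Rightarrow> real \<Rightarrow> real \<Rightarrow> (real \<Rightarrow> real) \<Rightarrow> bool" where
  "admissible \<xi> a d0 b d \<longleftrightarrow> a \<le> b \<and>
     (\<exists>u. u \<in> borel_measurable (lebesgue_on {a..b}) \<and>
          (\<forall>t\<in>{a..b}. u t \<in> {0..1 - \<xi>}) \<and>
          (\<forall>t\<in>{a..b}. d t = d0 + integral {a..t} u))"

definition admissible_area ::
  "real \<Rightarrow> real \<Rightarrow> real \<Rightarrow> real \<Rightarrow> real \<Rightarrow> (real \<Rightarrow> real) \<Rightarrow> bool" where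
  "admissible_area \<xi> a d0 K b d \<longleftrightarrow> admissible \<xi> a d0 b d \<and> integral {a..b} d \<le> K"

text \<open>As \<open>d\<close> decreases to \<open>0\<close>, \<open>nu x (x - d)\<close> tends to \<open>\<infinity>\<close>; hence both terms of the cost take
  the value \<open>\<infinity>\<close> where \<open>d = 0\<close> (where the real-valued \<open>nu\<close> would evaluate to \<open>0\<close>).\<close>

definition cost ::
  "real \<Rightarrow> real \<Rightarrow> real \<Rightarrow> real \<Rightarrow> real \<Rightarrow> real \<Rightarrow> (real \<Rightarrow> real) \<Rightarrow> ereal" where
  "cost \<alpha> \<beta> \<epsilon> q a b d =
     enn2ereal (\<integral>\<^sup>+t\<in>{a..b}. (if d t > 0 then ennreal (nu \<alpha> \<beta> \<epsilon> q t (t - d t)) else \<infinity>) \<partial>lborel)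
     + (if d b > 0 then ereal (ln (nu \<alpha> \<beta> \<epsilon> q b (b - d b))) else \<infinity>)"

definition optimal ::
  "(real \<Rightarrow> (real \<Rightarrow> real) \<Rightarrow> bool) \<Rightarrow> (real \<Rightarrow> (real \<Rightarrow> real) \<Rightarrow> ereal)
     \<Rightarrow> real \<Rightarrow> (real \<Rightarrow> real) \<Rightarrow> bool" where
  "optimal feasible J b d \<longleftrightarrow>
     feasible b d \<and> J b d < \<infinity> \<and> (\<forall>b' d'. feasible b' d' \<longrightarrow> J b d \<le> J b' d')"

definition max_slope_profile :: "real \<Rightarrow> real \<Rightarrow> real \<Rightarrow> real \<Rightarrow> real" where
  "max_slope_profile \<xi> a d0 t = d0 + (1 - \<xi>) * (t - a)"


section \<open>Structure equation and pieces of a draw-down function\<close>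

definition log_ratio :: "real \<Rightarrow> real \<Rightarrow> real \<Rightarrow> real \<Rightarrow> real" where
  "log_ratio \<alpha> \<beta> x \<delta> = ln ((\<alpha> * x + \<beta>) / (\<alpha> * (x - \<delta>) + \<beta>))"

definition structure_eq :: "real \<Rightarrow> real \<Rightarrow> real \<Rightarrow> real \<Rightarrow> real \<Rightarrow> real \<Rightarrow> real \<Rightarrow> bool" where
  "structure_eq \<alpha> \<beta> \<epsilon> q r x \<Delta> \<longleftrightarrow>
     r_plus \<alpha> \<epsilon> q * exp (r_plus \<alpha> \<epsilon> q * \<Delta>) - r_minus \<alpha> \<epsilon> q * exp (r_minus \<alpha> \<epsilon> q * \<Delta>)
     = (1 - 2 / (\<epsilon>\<^sup>2 * \<alpha>)
         + sqrt ((1 - 2 / (\<epsilon>\<^sup>2 * \<alpha>))\<^sup>2 + 8 * q / (\<epsilon>\<^sup>2 * \<alpha>\<^sup>2)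
                 + 4 * r * (x + \<beta> / \<alpha>)\<^sup>2 * exp (- \<Delta>))) / 2
       * (exp (r_plus \<alpha> \<epsilon> q * \<Delta>) - exp (r_minus \<alpha> \<epsilon> q * \<Delta>))"

text \<open>The costate of \<open>d\<close>, i.e. the coefficient of \<open>u\<close> in the Hamiltonian
  \<open>H = nu t (t - d) + p * u + r * d\<close>: the solution of \<open>p' = - \<partial>H/\<partial>d\<close> with \<open>p b\<close> the
  derivative of \<open>ln (nu b (b - d))\<close> in \<open>d\<close>.\<close>

definition costate ::
  "real \<Rightarrow> real \<Rightarrow> real \<Rightarrow> real \<Rightarrow> real \<Rightarrow> real \<Rightarrow> (real \<Rightarrow> real) \<Rightarrow> real \<Rightarrow> real" where
  "costate \<alpha> \<beta> \<epsilon> q r b d t =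
     - d2_nu \<alpha> \<beta> \<epsilon> q b (b - d b) / nu \<alpha> \<beta> \<epsilon> q b (b - d b)
     - integral {t..b} (\<lambda>s. d2_nu \<alpha> \<beta> \<epsilon> q s (s - d s) - r)"

definition structure_piece ::
  "real \<Rightarrow> real \<Rightarrow> real \<Rightarrow> real \<Rightarrow> real \<Rightarrow> (real \<Rightarrow> real) \<Rightarrow> real \<Rightarrow> real \<Rightarrow> bool" where
  "structure_piece \<alpha> \<beta> \<epsilon> q r d s t \<longleftrightarrow>
     (\<exists>\<Delta>. \<forall>x\<in>{s..t}. structure_eq \<alpha> \<beta> \<epsilon> q r x (\<Delta> x) \<and>
                       d x = (x + \<beta> / \<alpha>) * (1 - exp (- \<Delta> x)))"

definition max_slope_piece :: "real \<Rightarrow> (real \<Rightarrow> real) \<Rightarrow> real \<Rightarrow> real \<Rightarrow> bool" where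
  "max_slope_piece \<xi> d s t \<longleftrightarrow> (\<forall>x\<in>{s..t}. d x = d s + (1 - \<xi>) * (x - s))"

text \<open>The lower control bound \<open>u = 0\<close> is active: this is what the minimum condition on the
  Hamiltonian prescribes where the coefficient of \<open>u\<close> is positive.\<close>

definition rest_piece ::
  "real \<Rightarrow> real \<Rightarrow> real \<Rightarrow> real \<Rightarrow> real \<Rightarrow> real \<Rightarrow> (real \<Rightarrow> real) \<Rightarrow> real \<Rightarrow> real \<Rightarrow> bool" where
  "rest_piece \<alpha> \<beta> \<epsilon> q r b d s t \<longleftrightarrow>
     (\<forall>x\<in>{s..t}. d x = d s) \<and> (\<forall>x\<in>{s<..<t}. costate \<alpha> \<beta> \<epsilon> q r b d x > 0)"

definition piecewise :: "(real \<Rightarrow> real \<Rightarrow> bool) \<Rightarrow> real \<Rightarrow> real \<Rightarrow> bool" where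
  "piecewise P a b \<longleftrightarrow>
     (\<exists>(n::nat) \<tau>. \<tau> 0 = a \<and> \<tau> n = b \<and> (\<forall>i<n. \<tau> i < \<tau> (Suc i) \<and> P (\<tau> i) (\<tau> (Suc i))))"

end

theory Submission
  imports Defs
begin

text \<open>In the coordinates \<open>X = x + \<beta>/\<alpha>\<close>, \<open>Y = y + \<beta>/\<alpha>\<close> the derivative \<open>\<partial>\<^sub>2\<nu>\<close> equals
  \<open>1/H\<^sup>2\<close>, where \<open>H\<close> is positive and homogeneous of degree 1; with \<open>k = r\<^sub>+ - r\<^sub>-\<close> it is convex for
  \<open>k \<ge> 1\<close>, and for \<open>k \<le> 1\<close> it is nondecreasing along every draw-down path (slopes in \<open>[0, 1]\<close>). Positivity makes the cost
  strictly decreasing in the draw-down, which is part (1).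

  For part (2), the first variation of the cost and a separating line in the plane of pairs (change of
  area, first variation) give a multiplier \<open>r \<ge> 0\<close>; the constant profile, where the separation
  degenerates, is beaten by stopping slightly earlier and ending with a steep stretch. The second mean
  value theorem turns the multiplier inequality into the minimum condition: maximal slope where the
  costate is negative, rest where it is positive. If \<open>k \<le> 1\<close> the costate is concave, and if
  \<open>k \<ge> 1\<close> convexity of \<open>H\<close> excludes arcs of nonzero costate between interior contact points,
  so the costate changes sign only finitely often. The multiplier is positive unless the profile has
  maximal slope throughout.\<close>

section \<open>The gap function\<close>

text \<open>\<open>\<nu>\<close> depends on the log-ratio only through \<open>\<mu>\<close>, and
  \<open>\<mu>\<close> solves a Riccati equation. This yields both the quadratic behind the square
  root in \<open>structure_eq\<close> and the reciprocal square for the derivative in the second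
  variable. The threshold k = 1 comes from sinh (k * z) / sinh z, which is nonincreasing on z > 0
  for k <= 1 and nondecreasing for k >= 1; with z half the log-ratio, \<open>gap\<close> is this
  quotient times (X - Y) / k. The obstacle is finiteness: a priori the zero set of a C^1 costate can
  be a quite arbitrary closed set, so the minimum condition alone need not produce finitely many
  pieces. But d is prescribed on every arc of nonzero costate, so the evolution of
  \<open>gap\<close> along the arc is known, and with it the behaviour of the derivative of the
  costate. An arc that starts at the first zero of the costate needs separate treatment: the costate
  may be positive to the left of that zero, which then is no local maximum. The constraint is a
  single number, so the separation can take place in the plane instead of a function space.\<close>

lemma sinh_scale_le:
  fixes k x y :: real
  assumes "0 < k" "k \<le> 1" "0 < x" "x \<le> y"
  shows "sinh (k * y) * sinh x \<le> sinh (k * x) * sinh y"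
proof -
  \<comment> \<open>\<open>F\<close> is minus the numerator of the derivative of
    \<open>sinh (k * z) / sinh z\<close>; it vanishes at 0, and its own derivative has the sign of 1
    - k^2.\<close>
  define F where "F z = sinh (k * z) * cosh z - k * cosh (k * z) * sinh z" for z :: real
  have F': "(F has_real_derivative (1 - k\<^sup>2) * (sinh (k * z) * sinh z)) (at z)" for z
    unfolding F_def by (auto intro!: derivative_eq_intros simp: algebra_simps power2_eq_square)
  have F0: "F z \<ge> 0" if "z \<ge> 0" for z
  proof -
    have "F 0 \<le> F z"
    proof (rule DERIV_nonneg_imp_nondecreasing [OF that])
      fix w :: real assume "0 \<le> w" "w \<le> z"
      moreover have "1 - k\<^sup>2 \<ge> 0" using assms by (simp add: power_le_one)
      ultimately show "\<exists>D. (F has_real_derivative D) (at w) \<and> 0 \<le> D"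
        using assms by (intro exI [of _ "(1 - k\<^sup>2) * (sinh (k * w) * sinh w)"] conjI F') simp
    qed
    thus ?thesis by (simp add: F_def)
  qed
  have "sinh (k * y) / sinh y \<le> sinh (k * x) / sinh x"
  proof (rule DERIV_nonpos_imp_nonincreasing [OF assms(4)])
    fix z :: real assume z: "x \<le> z" "z \<le> y"
    hence "sinh z > 0" using assms by simp
    hence "((\<lambda>z. sinh (k * z) / sinh z) has_real_derivative - F z / (sinh z)\<^sup>2) (at z)"
      unfolding F_def by (auto intro!: derivative_eq_intros simp: algebra_simps power2_eq_square)
    thus "\<exists>D. ((\<lambda>z. sinh (k * z) / sinh z) has_real_derivative D) (at z) \<and> D \<le> 0"
      using F0 [of z] z assms by (intro exI conjI) (auto simp: divide_nonpos_nonneg)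
  qed
  thus ?thesis using assms by (simp add: field_simps)
qed

text \<open>Rescaling z by k turns the quotient for k into the reciprocal of the quotient for 1 / k,
  and 1 / k is at most 1.\<close>

lemma sinh_scale_ge:
  fixes k x y :: real
  assumes "1 \<le> k" "0 < x" "x \<le> y"
  shows "sinh (k * x) * sinh y \<le> sinh (k * y) * sinh x"
  using sinh_scale_le [of "1 / k" "k * x" "k * y"] assms by (simp add: mult.commute)

text \<open>For \<open>k = 1\<close> this is \<open>X - Y\<close>; in general it is \<open>\<partial>\<^sub>2\<nu> powr (-1/2)\<close> in the coordinates
  \<open>X = x + \<beta>/\<alpha>\<close>, \<open>Y = y + \<beta>/\<alpha>\<close>. It is homogeneous of degree 1, which makes its behaviour
  along straight lines tractable.\<close>

definition gap :: "real \<Rightarrow> real \<Rightarrow> real \<Rightarrow> real" where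
  "gap k X Y = 2 * sinh (k * ((ln X - ln Y) / 2)) * sqrt (X * Y) / k"

lemma gap_pos:
  assumes "0 < k" "0 < Y" "Y < X"
  shows "0 < gap k X Y"
  using assms by (simp add: gap_def)

lemma exp_half_ln:
  fixes z :: real
  assumes "z > 0"
  shows "exp (ln z / 2) = sqrt z"
  using assms by (intro real_sqrt_unique [symmetric]) (simp_all add: power2_eq_square flip: exp_add)

text \<open>The case k = 1 of \<open>gap\<close>: X - Y is the yardstick against which the general
  gap is measured.\<close>

lemma diff_eq_sinh:
  fixes X Y :: real
  assumes "0 < Y" "0 < X"
  shows "X - Y = 2 * sinh ((ln X - ln Y) / 2) * sqrt (X * Y)"
proof -
  have "2 * sinh ((ln X - ln Y) / 2) = sqrt X / sqrt Y - sqrt Y / sqrt X"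
    using assms by (simp add: sinh_def diff_divide_distrib exp_diff exp_half_ln)
  also have "\<dots> * sqrt (X * Y) = X - Y"
    using assms by (simp add: real_sqrt_mult field_simps)
  finally show ?thesis by simp
qed

text \<open>The square root cancels against that in \<open>diff_eq_sinh\<close>: with z half the
  log-ratio, \<open>gap\<close> is (X - Y) * sinh (k * z) / (k * sinh z), so the two preceding
  inequalities apply as soon as X - Y is controlled.\<close>

lemma gap_mult_sinh:
  assumes "0 < Y" "0 < X" "0 < k"
  shows "gap k X Y * sinh ((ln X - ln Y) / 2) * k = sinh (k * ((ln X - ln Y) / 2)) * (X - Y)"
  unfolding gap_def diff_eq_sinh [OF assms(1,2)] using assms by simp

text \<open>If the log-ratio grows, both factors in the definition of \<open>gap\<close> grow. If it
  shrinks, \<open>sinh_scale_le\<close> makes the quotient in \<open>gap_mult_sinh\<close> grow, and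
  X - Y does not shrink because \<open>\<sigma> \<le> \<tau>\<close>.\<close>

lemma gap_increasing:
  assumes k: "0 < k" "k \<le> 1" and XY: "0 < Y" "Y < X" and "0 \<le> \<sigma>" "\<sigma> \<le> \<tau>"
  shows "gap k X Y \<le> gap k (X + \<tau>) (Y + \<sigma>)"
proof -
  define z z' where "z = (ln X - ln Y) / 2" and "z' = (ln (X + \<tau>) - ln (Y + \<sigma>)) / 2"
  have zpos: "z > 0" "z' > 0" using assms by (simp_all add: z_def z'_def)
  show ?thesis
  proof (cases "z \<le> z'")
    case True
    have "sinh (k * z) * sqrt (X * Y) \<le> sinh (k * z') * sqrt ((X + \<tau>) * (Y + \<sigma>))"
      using True assms zpos by (intro mult_mono) (auto intro!: mult_mono)
    thus ?thesis using k unfolding gap_def z_def z'_def by (simp add: divide_right_mono)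
  next
    case False
    have "sinh (k * z) * sinh z' \<le> sinh (k * z') * sinh z"
      using False zpos k by (intro sinh_scale_le) auto
    hence "sinh (k * z) * sinh z' * (X - Y) \<le> sinh (k * z') * sinh z * (X + \<tau> - (Y + \<sigma>))"
      using zpos k assms by (intro mult_mono [OF _ _ mult_nonneg_nonneg]) auto
    moreover have "gap k X Y * sinh z * k = sinh (k * z) * (X - Y)"
      using gap_mult_sinh [of Y X k] XY k by (simp add: z_def)
    moreover have "gap k (X + \<tau>) (Y + \<sigma>) * sinh z' * k = sinh (k * z') * (X + \<tau> - (Y + \<sigma>))"
      using gap_mult_sinh [of "Y + \<sigma>" "X + \<tau>" k] assms by (simp add: z'_def)
    ultimately have "gap k X Y * sinh z * k * sinh z' \<le> gap k (X + \<tau>) (Y + \<sigma>) * sinh z' * k * sinh z"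
      by (simp add: mult_ac)
    hence "gap k X Y * (sinh z * k * sinh z') \<le> gap k (X + \<tau>) (Y + \<sigma>) * (sinh z * k * sinh z')"
      by (simp add: mult_ac)
    moreover have "sinh z * k * sinh z' > 0" using zpos k by simp
    ultimately show ?thesis using mult_le_cancel_right_pos by blast
  qed
qed

text \<open>A common shift preserves X - Y and lowers the log-ratio z, and for k >= 1 the quotient
  sinh (k * z) / sinh z falls with z. This describes a stretch of constant draw-down.\<close>

lemma gap_parallel_decreasing:
  assumes k: "1 \<le> k" and XY: "0 < Y" "Y < X" and "0 \<le> \<tau>"
  shows "gap k (X + \<tau>) (Y + \<tau>) \<le> gap k X Y"
proof -
  define z z' where "z = (ln X - ln Y) / 2" and "z' = (ln (X + \<tau>) - ln (Y + \<tau>)) / 2"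
  have zpos: "z > 0" "z' > 0" using assms by (simp_all add: z_def z'_def)
  have "(X + \<tau>) * Y \<le> X * (Y + \<tau>)"
    using assms by (simp add: algebra_simps mult_right_mono)
  hence "ln ((X + \<tau>) * Y) \<le> ln (X * (Y + \<tau>))"
    using assms by (intro ln_mono) auto
  hence "z' \<le> z" using assms by (simp add: z_def z'_def ln_mult)
  hence "sinh (k * z') * sinh z \<le> sinh (k * z) * sinh z'"
    using zpos k by (intro sinh_scale_ge) auto
  hence "sinh (k * z') * sinh z * (X - Y) \<le> sinh (k * z) * sinh z' * (X - Y)"
    using XY by (intro mult_right_mono) auto
  moreover have "gap k X Y * sinh z * k = sinh (k * z) * (X - Y)"
    using gap_mult_sinh [of Y X k] XY k by (simp add: z_def)
  moreover have "gap k (X + \<tau>) (Y + \<tau>) * sinh z' * k = sinh (k * z') * (X - Y)"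
    using gap_mult_sinh [of "Y + \<tau>" "X + \<tau>" k] assms by (simp add: z'_def)
  ultimately have "gap k (X + \<tau>) (Y + \<tau>) * sinh z' * k * sinh z \<le> gap k X Y * sinh z * k * sinh z'"
    by (simp add: mult_ac)
  hence "gap k (X + \<tau>) (Y + \<tau>) * (sinh z * k * sinh z') \<le> gap k X Y * (sinh z * k * sinh z')"
    by (simp add: mult_ac)
  moreover have "sinh z * k * sinh z' > 0" using zpos k by simp
  ultimately show ?thesis using mult_le_cancel_right_pos by blast
qed

section \<open>Homogeneity and convexity of the gap\<close>

definition gap_profile :: "real \<Rightarrow> real \<Rightarrow> real" where
  "gap_profile k s = (s powr (- (k - 1) / 2) - s powr ((k + 1) / 2)) / k"

text \<open>Degree-one homogeneity: \<open>gap\<close> is the perspective of its slice at X =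
  1.\<close>

lemma gap_eq_profile:
  assumes "0 < X" "0 < Y"
  shows "gap k X Y = X * gap_profile k (Y / X)"
proof -
  define x y where "x = ln X" and "y = ln Y"
  have XY: "X = exp x" "Y = exp y" using assms by (simp_all add: x_def y_def)
  have s: "sqrt (X * Y) = exp ((x + y) / 2)"
    using assms exp_half_ln [of "X * Y"] by (simp add: x_def y_def ln_mult)
  have l: "ln (Y / X) = y - x" using assms by (simp add: x_def y_def ln_div)
  have "2 * sinh (k * ((x - y) / 2)) * exp ((x + y) / 2)
      = exp x * (exp (- (k - 1) / 2 * (y - x)) - exp ((k + 1) / 2 * (y - x)))"
    by (simp add: sinh_def algebra_simps add_divide_distrib diff_divide_distrib flip: exp_add)
  thus ?thesis
    using assms unfolding gap_def gap_profile_def s powr_def l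
    by (simp add: x_def [symmetric] y_def [symmetric] XY(1) [symmetric])
qed

text \<open>The exponents m and n add up to 1, hence m (m - 1) = n (n - 1) = (k^2 - 1) / 4. So the
  second derivative is a nonnegative multiple of \<open>s powr (m - 2) - s powr (n - 2)\<close>,
  which is nonnegative for s < 1 because \<open>m \<le> n\<close>.\<close>

lemma gap_profile_convex:
  assumes "1 \<le> k"
  shows "convex_on {0<..<1} (gap_profile k)"
proof (rule f''_ge0_imp_convex)
  define m n where "m = - (k - 1) / 2" and "n = (k + 1) / 2"
  fix s :: real assume s: "s \<in> {0<..<1}"
  show "(gap_profile k has_real_derivative (m * s powr (m - 1) - n * s powr (n - 1)) / k) (at s)"
    using s assms unfolding gap_profile_def [abs_def] m_def [symmetric] n_def [symmetric]
    by (auto intro!: derivative_eq_intros)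
  show "((\<lambda>s. (m * s powr (m - 1) - n * s powr (n - 1)) / k) has_real_derivative
          (m * ((m - 1) * s powr (m - 2)) - n * ((n - 1) * s powr (n - 2))) / k) (at s)"
    using s assms by (auto intro!: derivative_eq_intros)
  have "m * (m - 1) = n * (n - 1)"
    by (simp add: m_def n_def field_simps)
  moreover have "n * (n - 1) \<ge> 0" using assms by (simp add: n_def)
  moreover have "s powr (n - 2) \<le> s powr (m - 2)"
    using s assms by (intro powr_mono') (auto simp: m_def n_def)
  ultimately show "(m * ((m - 1) * s powr (m - 2)) - n * ((n - 1) * s powr (n - 2))) / k \<ge> 0"
    using assms by (simp add: mult_left_mono flip: mult.assoc)
qed simp

text \<open>The perspective of a convex function is jointly convex.\<close>

lemma gap_convex:
  assumes k: "1 \<le> k" and XY: "0 < Y1" "Y1 < X1" "0 < Y2" "Y2 < X2" and w: "0 \<le> w" "w \<le> 1"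
  shows "gap k ((1 - w) * X1 + w * X2) ((1 - w) * Y1 + w * Y2) \<le> (1 - w) * gap k X1 Y1 + w * gap k X2 Y2"
proof -
  define X Y where "X = (1 - w) * X1 + w * X2" and "Y = (1 - w) * Y1 + w * Y2"
  have pos: "X > 0" "Y > 0"
    using XY w unfolding X_def Y_def by (smt (verit) mult_nonneg_nonneg mult_pos_pos)+
  \<comment> \<open>The weight of the second point after normalisation by X: with 1 - v and v, the
    slopes Y1 / X1 and Y2 / X2 combine to Y / X.\<close>
  define v where "v = w * X2 / X"
  have v: "0 \<le> v" "v \<le> 1" "1 - v = (1 - w) * X1 / X"
    using pos w XY by (auto simp: v_def field_simps X_def)
  have "gap_profile k ((1 - v) *\<^sub>R (Y1 / X1) + v *\<^sub>R (Y2 / X2))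
      \<le> (1 - v) * gap_profile k (Y1 / X1) + v * gap_profile k (Y2 / X2)"
    using XY by (intro convex_onD [OF gap_profile_convex [OF k]] v) auto
  moreover have "(1 - v) *\<^sub>R (Y1 / X1) + v *\<^sub>R (Y2 / X2) = Y / X"
    unfolding v(3) unfolding v_def using XY pos by (simp add: Y_def add_divide_distrib)
  ultimately have "X * gap_profile k (Y / X)
      \<le> X * ((1 - v) * gap_profile k (Y1 / X1) + v * gap_profile k (Y2 / X2))"
    using pos by (intro mult_left_mono) auto
  also have "\<dots> = (1 - w) * (X1 * gap_profile k (Y1 / X1)) + w * (X2 * gap_profile k (Y2 / X2))"
    unfolding v(3) unfolding v_def using pos by (simp add: distrib_left)
  finally show ?thesis
    using XY pos gap_eq_profile [of _ _ k] unfolding X_def [symmetric] Y_def [symmetric]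
    by (simp)
qed

section \<open>Logarithmic derivative of the scale function\<close>

locale gbm =
  fixes \<alpha> \<beta> \<epsilon> q :: real
  assumes alpha_pos: "\<alpha> > 0" and eps_pos: "\<epsilon> > 0" and q_pos: "q > 0"
begin

abbreviation \<nu> where "\<nu> \<equiv> nu \<alpha> \<beta> \<epsilon> q"
abbreviation d2\<nu> where "d2\<nu> \<equiv> d2_nu \<alpha> \<beta> \<epsilon> q"
abbreviation \<mu> where "\<mu> \<equiv> mu \<alpha> \<epsilon> q"

abbreviation shift :: "real \<Rightarrow> real" where "shift x \<equiv> x + \<beta> / \<alpha>"

definition rp where "rp = r_plus \<alpha> \<epsilon> q"
definition rm where "rm = r_minus \<alpha> \<epsilon> q"
definition k where "k = rp - rm"
definition A where "A = 1 - 2 / (\<epsilon>\<^sup>2 * \<alpha>)"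
definition B where "B = 8 * q / (\<epsilon>\<^sup>2 * \<alpha>\<^sup>2)"

lemma B_pos: "B > 0"
  using alpha_pos eps_pos q_pos by (simp add: B_def)

lemma rp_rm: "rp = (A + sqrt (A\<^sup>2 + B)) / 2" "rm = (A - sqrt (A\<^sup>2 + B)) / 2"
  by (simp_all add: rp_def rm_def r_plus_def r_minus_def A_def B_def)

lemma k_pos: "k > 0"
  using B_pos by (simp add: k_def rp_rm field_simps add_pos_nonneg)

lemma rp_pos: "rp > 0"
proof -
  have "\<bar>A\<bar> < sqrt (A\<^sup>2 + B)"
    using B_pos by (intro real_less_rsqrt) simp
  thus ?thesis by (simp add: rp_rm)
qed

lemma rp_plus_rm: "rp + rm = A"
  by (simp add: rp_rm field_simps)

lemma rp_times_rm: "4 * (rp * rm) = - B"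
proof -
  have "4 * (rp * rm) = A\<^sup>2 - (sqrt (A\<^sup>2 + B))\<^sup>2"
    unfolding rp_rm by (simp add: field_simps power2_eq_square)
  thus ?thesis using B_pos by (simp add: add_nonneg_nonneg)
qed

lemma shift_pos_iff: "\<alpha> * x + \<beta> > 0 \<longleftrightarrow> shift x > 0"
  using alpha_pos by (simp add: field_simps)

lemma affine_eq_shift: "\<alpha> * x + \<beta> = \<alpha> * shift x"
  using alpha_pos by (simp add: field_simps)

lemma ln_ratio_eq:
  assumes "shift x > 0" "shift y > 0"
  shows "ln ((\<alpha> * x + \<beta>) / (\<alpha> * y + \<beta>)) = ln (shift x) - ln (shift y)"
  using assms alpha_pos unfolding affine_eq_shift by (simp add: ln_div)

text \<open>Cancelling the common factor exp (rm * z) leaves exp (k * z) as the only exponential, so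
  bounds and derivative become explicit.\<close>

lemma mu_eq:
  assumes "z > 0"
  shows "\<mu> z = rp + k / (exp (k * z) - 1)"
proof -
  define E F where "E = exp (k * z)" and "F = exp (rm * z)"
  have EF: "exp (rp * z) = E * F"
    by (simp add: E_def F_def k_def algebra_simps flip: exp_add)
  have "E > 1" "F > 0" using k_pos assms by (simp_all add: E_def F_def)
  hence "(rp * (E * F) - rm * F) / (E * F - F) = rp + (rp - rm) / (E - 1)"
    by (simp add: divide_simps) (simp add: algebra_simps)
  thus ?thesis
    unfolding mu_def deriv_omega omega_def rp_def [symmetric] rm_def [symmetric] EF
      F_def [symmetric] E_def [symmetric] by (simp add: k_def)
qed

lemma mu_gt_rp: "z > 0 \<Longrightarrow> \<mu> z > rp"
  using k_pos by (simp add: mu_eq)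

lemma mu_pos: "z > 0 \<Longrightarrow> \<mu> z > 0"
  using mu_gt_rp [of z] rp_pos by simp

lemma exp_sinh: "(exp z - 1)\<^sup>2 = exp z * (2 * sinh (z / 2))\<^sup>2" for z :: real
proof -
  have "exp z = exp (z / 2) * exp (z / 2)" by (simp flip: exp_add)
  thus ?thesis
    by (simp add: sinh_def exp_minus field_simps power2_eq_square)
qed

lemma mu_derivative:
  assumes "z > 0"
  shows "(\<mu> has_real_derivative - (k / (2 * sinh (k * z / 2)))\<^sup>2) (at z)"
proof (rule has_field_derivative_transform_within_open [where S = "{0<..}"])
  have E: "exp (k * z) > 1" using k_pos assms by simp
  have "((\<lambda>z. rp + k / (exp (k * z) - 1)) has_real_derivative - (k\<^sup>2 * exp (k * z)) / (exp (k * z) - 1)\<^sup>2) (at z)"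
    using E by (auto intro!: derivative_eq_intros simp: power2_eq_square)
  also have "- (k\<^sup>2 * exp (k * z)) / (exp (k * z) - 1)\<^sup>2 = - (k / (2 * sinh (k * z / 2)))\<^sup>2"
    unfolding exp_sinh by (simp add: power_divide)
  finally show "((\<lambda>z. rp + k / (exp (k * z) - 1)) has_real_derivative - (k / (2 * sinh (k * z / 2)))\<^sup>2) (at z)" .
qed (use assms in \<open>auto simp: mu_eq\<close>)

text \<open>The derivative in \<open>mu_derivative\<close> is minus (\<mu> z - rp) * (\<mu> z - rm),
  the Riccati equation of a logarithmic derivative. Completing the square with rp + rm = A and 4 *
  (rp * rm) = - B gives this form, the source of the square root in
  \<open>structure_eq\<close>.\<close>

lemma mu_quadratic:
  assumes "z > 0"
  shows "(2 * \<mu> z - A)\<^sup>2 = A\<^sup>2 + B + 4 * (k / (2 * sinh (k * z / 2)))\<^sup>2"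
proof -
  define E where "E = exp (k * z)"
  have E: "E > 1" using k_pos assms by (simp add: E_def)
  have rm: "rm = rp - k" by (simp add: k_def)
  have "(k / (2 * sinh (k * z / 2)))\<^sup>2 = k\<^sup>2 * E / (E - 1)\<^sup>2"
    unfolding E_def exp_sinh by (simp add: power_divide)
  also have "\<dots> = (\<mu> z - rp) * (\<mu> z - rm)"
    using E rm unfolding mu_eq [OF assms] E_def [symmetric]
    by (simp add: divide_simps) (simp add: algebra_simps power2_eq_square)
  also have "4 * \<dots> = (2 * \<mu> z)\<^sup>2 - 4 * \<mu> z * (rp + rm) + 4 * (rp * rm)"
    by (simp add: algebra_simps power2_eq_square)
  finally show ?thesis
    unfolding rp_plus_rm rp_times_rm by (simp add: power2_eq_square algebra_simps)
qed

lemma nu_eq: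
  assumes "shift x > 0" "shift y > 0"
  shows "\<nu> x y = \<mu> (ln (shift x) - ln (shift y)) / shift x"
  unfolding nu_def ln_ratio_eq [OF assms] unfolding affine_eq_shift
  using alpha_pos by simp

lemma nu_pos:
  assumes "shift y > 0" "y < x"
  shows "\<nu> x y > 0"
  using assms by (subst nu_eq) (auto intro!: divide_pos_pos mu_pos)

text \<open>The chain rule gives minus the derivative of \<open>\<mu>\<close>, divided by X * Y, and
  \<open>mu_derivative\<close> makes this a reciprocal square.\<close>

lemma d2_nu_eq:
  assumes "shift y > 0" "y < x"
  shows "d2\<nu> x y = 1 / (gap k (shift x) (shift y))\<^sup>2"
proof -
  define z where "z = ln (shift x) - ln (shift y)"
  have x: "shift x > 0" using assms by simp
  have z: "z > 0" using assms by (simp add: z_def)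
  have "((\<lambda>v. ln ((\<alpha> * x + \<beta>) / (\<alpha> * v + \<beta>))) has_real_derivative - (\<alpha> / (\<alpha> * y + \<beta>))) (at y)"
    using assms x unfolding shift_pos_iff [symmetric] by (intro ln_ratio_derivs)
  moreover have "(\<mu> has_real_derivative - (k / (2 * sinh (k * z / 2)))\<^sup>2)
      (at (ln ((\<alpha> * x + \<beta>) / (\<alpha> * y + \<beta>))))"
    using mu_derivative [OF z] ln_ratio_eq [OF x assms(1)] by (simp add: z_def)
  ultimately have "(\<nu> x has_real_derivative
      \<alpha> / (\<alpha> * x + \<beta>) * (- (k / (2 * sinh (k * z / 2)))\<^sup>2 * - (\<alpha> / (\<alpha> * y + \<beta>)))) (at y)"
    unfolding nu_def [abs_def] by (intro DERIV_cmult DERIV_chain2)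
  hence "d2\<nu> x y = \<alpha> / (\<alpha> * x + \<beta>) * (- (k / (2 * sinh (k * z / 2)))\<^sup>2 * - (\<alpha> / (\<alpha> * y + \<beta>)))"
    unfolding d2_nu_def by (rule DERIV_imp_deriv)
  also have "\<dots> = (k / (2 * sinh (k * z / 2)))\<^sup>2 / (shift x * shift y)"
    using alpha_pos unfolding affine_eq_shift by simp
  also have "\<dots> = 1 / (gap k (shift x) (shift y))\<^sup>2"
    using assms x k_pos by (simp add: gap_def power_mult_distrib power_divide z_def)
  finally show ?thesis .
qed

lemma d2_nu_pos:
  assumes "shift y > 0" "y < x"
  shows "d2\<nu> x y > 0"
  using gap_pos [of k "shift y" "shift x"] assms k_pos by (simp add: d2_nu_eq)

lemma d2_nu_le_iff:
  assumes "shift y > 0" "y < x" "shift y' > 0" "y' < x'"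
  shows "d2\<nu> x y \<le> d2\<nu> x' y' \<longleftrightarrow> gap k (shift x') (shift y') \<le> gap k (shift x) (shift y)"
proof -
  have "1 / u\<^sup>2 \<le> 1 / v\<^sup>2 \<longleftrightarrow> v \<le> u" if "u > 0" "v > 0" for u v :: real
    using that by (simp add: frac_le_eq divide_simps power_mono_iff)
  thus ?thesis
    using gap_pos [of k "shift y" "shift x"] gap_pos [of k "shift y'" "shift x'"] assms k_pos
    by (simp only: d2_nu_eq)
qed

lemma nu_strict_mono:
  assumes "shift y > 0" "y < y'" "y' < x"
  shows "\<nu> x y < \<nu> x y'"
proof (rule DERIV_pos_imp_increasing [OF assms(2)])
  fix v assume v: "y \<le> v" "v \<le> y'"
  hence "(\<nu> x has_real_derivative d2\<nu> x v) (at v)"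
    using assms alpha_pos eps_pos q_pos
    by (intro d2_nu_has_derivative) (auto simp: shift_pos_iff)
  thus "\<exists>D. (\<nu> x has_real_derivative D) (at v) \<and> 0 < D"
    using d2_nu_pos [of v x] v assms by force
qed

lemma nu_mono:
  assumes "shift y > 0" "y \<le> y'" "y' < x"
  shows "\<nu> x y \<le> \<nu> x y'"
  using nu_strict_mono [of y y' x] assms by (cases "y = y'") auto

lemma continuous_on_nu:
  fixes f g :: "'b::t2_space \<Rightarrow> real"
  assumes "continuous_on S f" "continuous_on S g" "\<And>s. s \<in> S \<Longrightarrow> shift (g s) > 0 \<and> g s < f s"
  shows "continuous_on S (\<lambda>s. \<nu> (f s) (g s))"
proof -
  have "continuous_on S (\<lambda>s. (rp + k / (exp (k * (ln (shift (f s)) - ln (shift (g s)))) - 1)) / shift (f s))"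
  proof (intro continuous_intros assms(1,2) ballI)
    fix s assume s: "s \<in> S"
    have "ln (shift (g s)) < ln (shift (f s))"
      using assms(3) [OF s] by (subst ln_less_cancel_iff) linarith+
    thus "exp (k * (ln (shift (f s)) - ln (shift (g s)))) - 1 \<noteq> 0"
      using k_pos by simp
    show "shift (f s) \<noteq> 0" "shift (g s) \<noteq> 0" "shift (f s) \<noteq> 0" using assms(3) [OF s] by linarith+
  qed
  also have "?this \<longleftrightarrow> ?thesis"
  proof (intro continuous_on_cong refl)
    fix s assume "s \<in> S"
    thus "(rp + k / (exp (k * (ln (shift (f s)) - ln (shift (g s)))) - 1)) / shift (f s) = \<nu> (f s) (g s)"
      using assms(3) [of s] by (subst nu_eq) (auto simp: mu_eq)
  qed
  finally show ?thesis .
qed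

text \<open>The parameter space is arbitrary because the Leibniz rule needs joint continuity in the
  segment parameter and time.\<close>

lemma continuous_on_d2_nu:
  fixes f g :: "'b::t2_space \<Rightarrow> real"
  assumes "continuous_on S f" "continuous_on S g" "\<And>s. s \<in> S \<Longrightarrow> shift (g s) > 0 \<and> g s < f s"
  shows "continuous_on S (\<lambda>s. d2\<nu> (f s) (g s))"
proof -
  have "continuous_on S (\<lambda>s. 1 / (gap k (shift (f s)) (shift (g s)))\<^sup>2)"
    unfolding gap_def
  proof (intro continuous_intros assms(1,2) ballI)
    fix s assume s: "s \<in> S"
    show "shift (f s) \<noteq> 0" "shift (g s) \<noteq> 0" using assms(3) [OF s] by linarith+
    show "k \<noteq> 0" using k_pos by simp
    show "(2 * sinh (k * ((ln (shift (f s)) - ln (shift (g s))) / 2)) * sqrt (shift (f s) * shift (g s)) / k)\<^sup>2 \<noteq> 0"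
      using assms(3) [OF s] k_pos by (auto simp: order_less_imp_not_eq2)
  qed simp
  also have "?this \<longleftrightarrow> ?thesis"
    using assms(3) by (intro continuous_on_cong refl) (auto simp: d2_nu_eq)
  finally show ?thesis .
qed

lemma log_ratio_profile:
  assumes "0 < \<delta>" "shift (x - \<delta>) > 0"
  shows "log_ratio \<alpha> \<beta> x \<delta> = ln (shift x) - ln (shift (x - \<delta>))"
    and "\<delta> = shift x * (1 - exp (- log_ratio \<alpha> \<beta> x \<delta>))"
proof -
  have x: "shift x > 0" using assms by simp
  show 1: "log_ratio \<alpha> \<beta> x \<delta> = ln (shift x) - ln (shift (x - \<delta>))"
    unfolding log_ratio_def using ln_ratio_eq [OF x assms(2)] by simp
  have "exp (- log_ratio \<alpha> \<beta> x \<delta>) = shift (x - \<delta>) / shift x"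
    unfolding 1 using x assms by (simp add: exp_diff)
  thus "\<delta> = shift x * (1 - exp (- log_ratio \<alpha> \<beta> x \<delta>))"
    using x by (simp add: field_simps)
qed

text \<open>By \<open>mu_quadratic\<close> the equation prescribes the square of 2 * \<mu> z - A;
  the factor exp (- z) arises from X * Y = X^2 * exp (- z).\<close>

lemma structure_eq_iff:
  assumes "0 < \<delta>" "shift (x - \<delta>) > 0" "r \<ge> 0"
  shows "d2\<nu> x (x - \<delta>) = r \<longleftrightarrow> structure_eq \<alpha> \<beta> \<epsilon> q r x (log_ratio \<alpha> \<beta> x \<delta>)"
proof -
  define z where "z = log_ratio \<alpha> \<beta> x \<delta>"
  have x: "shift x > 0" using assms by simp
  have z: "z = ln (shift x) - ln (shift (x - \<delta>))" "z > 0"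
    using log_ratio_profile [OF assms(1,2)] assms by (simp_all add: z_def)
  have om: "omega \<alpha> \<epsilon> q z > 0"
    using omega_pos z alpha_pos eps_pos q_pos by blast
  have XY: "(shift x)\<^sup>2 * exp (- z) = shift x * shift (x - \<delta>)"
    unfolding z(1) using x assms by (simp add: exp_diff power2_eq_square)
  define R where "R = A\<^sup>2 + B + 4 * r * (shift x)\<^sup>2 * exp (- z)"
  have R0: "R \<ge> 0" using B_pos assms by (simp add: R_def add_nonneg_nonneg)
  \<comment> \<open>This makes squaring reversible: \<mu> z > rp and 2 * rp - A = k > 0 select the
    positive root.\<close>
  have pos: "2 * \<mu> z - A > 0"
    using mu_gt_rp [OF z(2)] k_pos rp_plus_rm by (simp add: k_def)
  have sh: "(k / (2 * sinh (k * z / 2)))\<^sup>2 = shift x * shift (x - \<delta>) * d2\<nu> x (x - \<delta>)"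
    using assms x k_pos
    by (simp add: d2_nu_eq gap_def power_mult_distrib power_divide z(1))
  have "structure_eq \<alpha> \<beta> \<epsilon> q r x z \<longleftrightarrow> \<mu> z = (A + sqrt R) / 2"
    unfolding structure_eq_def mu_def deriv_omega R_def A_def B_def
    using om unfolding omega_def by (subst nonzero_divide_eq_eq) auto
  also have "\<dots> \<longleftrightarrow> sqrt R = 2 * \<mu> z - A"
    by (auto simp: field_simps)
  also have "\<dots> \<longleftrightarrow> R = (2 * \<mu> z - A)\<^sup>2"
    using pos R0 real_sqrt_unique by (metis less_imp_le real_sqrt_pow2)
  also have "\<dots> \<longleftrightarrow> r * (shift x * shift (x - \<delta>)) = (k / (2 * sinh (k * z / 2)))\<^sup>2"
    unfolding mu_quadratic [OF z(2)] R_def using XY by (simp add: mult.assoc)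
  also have "\<dots> \<longleftrightarrow> d2\<nu> x (x - \<delta>) = r"
    unfolding sh using x assms by (auto simp: mult_ac)
  finally show ?thesis by (simp add: z_def)
qed

end

section \<open>Draw-down functions and their cost\<close>

text \<open>\<open>integral\<close> is the Henstock-Kurzweil integral, with a default value where it
  does not exist; measurability and the bounds on u guarantee existence, on subintervals
  too.\<close>

lemma admissible_bounded_slope:
  assumes "admissible \<xi> a d0 b d"
  obtains u where "u \<in> borel_measurable (lebesgue_on {a..b})" "\<And>t. t \<in> {a..b} \<Longrightarrow> 0 \<le> u t \<and> u t \<le> 1 - \<xi>"
    "\<And>t. t \<in> {a..b} \<Longrightarrow> d t = d0 + integral {a..t} u"
    "\<And>s t. a \<le> s \<Longrightarrow> t \<le> b \<Longrightarrow> u integrable_on {s..t}"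
proof -
  from assms obtain u where u: "u \<in> borel_measurable (lebesgue_on {a..b})"
    "\<And>t. t \<in> {a..b} \<Longrightarrow> 0 \<le> u t \<and> u t \<le> 1 - \<xi>" "\<And>t. t \<in> {a..b} \<Longrightarrow> d t = d0 + integral {a..t} u"
    unfolding admissible_def by auto
  have "u integrable_on {a..b}"
    by (rule measurable_bounded_by_integrable_imp_integrable_real [where g = "\<lambda>_. 1 - \<xi>", OF u(1)])
       (use u(2) in auto)
  hence "u integrable_on {s..t}" if "a \<le> s" "t \<le> b" for s t
    using that by (auto intro: integrable_on_subinterval)
  with u that show ?thesis by blast
qed

lemma admissible_le: "admissible \<xi> a d0 b d \<Longrightarrow> a \<le> b"
  by (simp add: admissible_def)

lemma admissible_start:
  assumes "admissible \<xi> a d0 b d"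
  shows "d a = d0"
proof -
  from admissible_bounded_slope [OF assms] obtain u where "\<And>t. t \<in> {a..b} \<Longrightarrow> d t = d0 + integral {a..t} u"
    by metis
  from this [of a] show ?thesis using admissible_le [OF assms] by simp
qed

lemma admissible_increment:
  assumes "admissible \<xi> a d0 b d" "a \<le> s" "s \<le> t" "t \<le> b"
  shows "d s \<le> d t" "d t \<le> d s + (1 - \<xi>) * (t - s)"
proof -
  obtain u where u: "u \<in> borel_measurable (lebesgue_on {a..b})" "\<And>t. t \<in> {a..b} \<Longrightarrow> 0 \<le> u t \<and> u t \<le> 1 - \<xi>"
    "\<And>t. t \<in> {a..b} \<Longrightarrow> d t = d0 + integral {a..t} u"
    "\<And>s t. a \<le> s \<Longrightarrow> t \<le> b \<Longrightarrow> u integrable_on {s..t}"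
    using admissible_bounded_slope [OF assms(1)] by metis
  have "integral {a..s} u + integral {s..t} u = integral {a..t} u"
    using assms u(4) by (intro Henstock_Kurzweil_Integration.integral_combine) auto
  hence eq: "d t = d s + integral {s..t} u"
    using u(3) [of s] u(3) [of t] assms by simp
  have "0 \<le> integral {s..t} u"
    using assms u(2,4) by (intro Henstock_Kurzweil_Integration.integral_nonneg) auto
  thus "d s \<le> d t" by (simp add: eq)
  have "integral {s..t} u \<le> integral {s..t} (\<lambda>_. 1 - \<xi>)"
    using assms u(2,4) by (intro integral_le) auto
  thus "d t \<le> d s + (1 - \<xi>) * (t - s)"
    using assms by (simp add: eq mult.commute)
qed

lemma admissible_continuous:
  assumes "admissible \<xi> a d0 b d"
  shows "continuous_on {a..b} d"
proof -
  obtain u where u: "\<And>t. t \<in> {a..b} \<Longrightarrow> d t = d0 + integral {a..t} u"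
    "\<And>s t. a \<le> s \<Longrightarrow> t \<le> b \<Longrightarrow> u integrable_on {s..t}"
    using admissible_bounded_slope [OF assms(1)] by metis
  have "continuous_on {a..b} (\<lambda>t. d0 + integral {a..t} u)"
    using u(2) by (intro continuous_intros indefinite_integral_continuous_1) auto
  thus ?thesis using u(1) by (subst continuous_on_cong [OF refl]) auto
qed

lemma admissible_convex:
  assumes d: "admissible \<xi> a d0 b d" and e: "admissible \<xi> a d0 b e" and w: "0 \<le> w" "w \<le> 1"
  shows "admissible \<xi> a d0 b (\<lambda>t. d t + w * (e t - d t))"
proof -
  obtain u where u: "u \<in> borel_measurable (lebesgue_on {a..b})" "\<And>t. t \<in> {a..b} \<Longrightarrow> 0 \<le> u t \<and> u t \<le> 1 - \<xi>"
    "\<And>t. t \<in> {a..b} \<Longrightarrow> d t = d0 + integral {a..t} u"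
    "\<And>s t. a \<le> s \<Longrightarrow> t \<le> b \<Longrightarrow> u integrable_on {s..t}"
    using admissible_bounded_slope [OF d] by metis
  obtain v where v: "v \<in> borel_measurable (lebesgue_on {a..b})" "\<And>t. t \<in> {a..b} \<Longrightarrow> 0 \<le> v t \<and> v t \<le> 1 - \<xi>"
    "\<And>t. t \<in> {a..b} \<Longrightarrow> e t = d0 + integral {a..t} v"
    "\<And>s t. a \<le> s \<Longrightarrow> t \<le> b \<Longrightarrow> v integrable_on {s..t}"
    using admissible_bounded_slope [OF e] by metis
  define z where "z t = u t + w * (v t - u t)" for t
  have "z \<in> borel_measurable (lebesgue_on {a..b})"
    using u(1) v(1) unfolding z_def [abs_def] by measurable
  moreover have "z t \<in> {0..1 - \<xi>}" if "t \<in> {a..b}" for t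
  proof -
    have "z t = (1 - w) *\<^sub>R u t + w *\<^sub>R v t" by (simp add: z_def algebra_simps)
    also have "\<dots> \<in> {0..1 - \<xi>}"
      using u(2) [OF that] v(2) [OF that] w by (intro convexD_alt [OF convex_closed_interval]) auto
    finally show ?thesis .
  qed
  moreover have "d t + w * (e t - d t) = d0 + integral {a..t} z" if "t \<in> {a..b}" for t
  proof -
    have "(z has_integral integral {a..t} u + w * (integral {a..t} v - integral {a..t} u)) {a..t}"
      unfolding z_def [abs_def] using that
      by (intro has_integral_add has_integral_mult_right has_integral_diff integrable_integral u v) auto
    hence "integral {a..t} z = integral {a..t} u + w * (integral {a..t} v - integral {a..t} u)"
      by (rule integral_unique)
    thus ?thesis using u(3) [OF that] v(3) [OF that] by simp
  qed
  ultimately show ?thesis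
    using admissible_le [OF d] unfolding admissible_def by blast
qed

text \<open>The control is overwritten by the constant m on one interval. For m = 0 and m = 1 -
  \<xi> these are the competitors behind the minimum condition: the difference from d is then
  monotone, 0 before s and constant after t.\<close>

lemma admissible_modify:
  assumes d: "admissible \<xi> a d0 b d" and st: "a \<le> s" "s \<le> t" "t \<le> b" and m: "0 \<le> m" "m \<le> 1 - \<xi>"
  obtains e where "admissible \<xi> a d0 b e" "\<And>x. a \<le> x \<Longrightarrow> x \<le> s \<Longrightarrow> e x = d x"
    "\<And>x. s \<le> x \<Longrightarrow> x \<le> t \<Longrightarrow> e x = d s + m * (x - s)"
    "\<And>x. t \<le> x \<Longrightarrow> x \<le> b \<Longrightarrow> e x - d x = e t - d t"
proof -
  obtain u where u: "u \<in> borel_measurable (lebesgue_on {a..b})" "\<And>t. t \<in> {a..b} \<Longrightarrow> 0 \<le> u t \<and> u t \<le> 1 - \<xi>"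
    "\<And>t. t \<in> {a..b} \<Longrightarrow> d t = d0 + integral {a..t} u"
    "\<And>s t. a \<le> s \<Longrightarrow> t \<le> b \<Longrightarrow> u integrable_on {s..t}"
    using admissible_bounded_slope [OF d] by metis
  define v where "v x = (if x \<in> {s..<t} then m else u x)" for x
  define e where "e x = d0 + integral {a..x} v" for x
  have "{x \<in> space (lebesgue_on {a..b}). x \<in> {s..<t}} = {s..<t}"
    using st by auto
  moreover have "{s..<t} \<in> sets (lebesgue_on {a..b})"
    using st by (subst sets_restrict_space_iff) auto
  ultimately have "v \<in> borel_measurable (lebesgue_on {a..b})"
    unfolding v_def [abs_def] using u(1) by (intro measurable_If) auto
  hence adm: "admissible \<xi> a d0 b e"
    unfolding admissible_def using admissible_le [OF d] u(2) m
    by (intro conjI exI [of _ v]) (auto simp: v_def e_def)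
  have vint: "v integrable_on {x..y}" if "a \<le> x" "y \<le> b" for x y
  proof -
    have "v integrable_on {a..b}"
      by (rule measurable_bounded_by_integrable_imp_integrable_real [where g = "\<lambda>_. 1 - \<xi>"])
         (use \<open>v \<in> _\<close> u(2) m in \<open>auto simp: v_def\<close>)
    thus ?thesis using that by (auto intro: integrable_on_subinterval)
  qed
  have step: "e y = e x + integral {x..y} v" "d y = d x + integral {x..y} u"
    if "a \<le> x" "x \<le> y" "y \<le> b" for x y
  proof -
    have "integral {a..x} v + integral {x..y} v = integral {a..y} v"
      using that vint by (intro Henstock_Kurzweil_Integration.integral_combine) auto
    thus "e y = e x + integral {x..y} v" by (simp add: e_def)
    have "integral {a..x} u + integral {x..y} u = integral {a..y} u"
      using that u(4) by (intro Henstock_Kurzweil_Integration.integral_combine) auto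
    thus "d y = d x + integral {x..y} u" using that u(3) by simp
  qed
  have 1: "e x = d x" if "a \<le> x" "x \<le> s" for x
  proof -
    have "integral {a..x} v = integral {a..x} u"
      using that by (intro integral_spike [of "{s}"]) (auto simp: v_def)
    thus ?thesis using that st u(3) by (simp add: e_def)
  qed
  show ?thesis
  proof (rule that [OF adm 1])
    fix x assume x: "s \<le> x" "x \<le> t"
    have "integral {s..x} v = integral {s..x} (\<lambda>_. m)"
      using x by (intro integral_spike [of "{t}"]) (auto simp: v_def)
    thus "e x = d s + m * (x - s)"
      using step(1) [of s x] x st 1 [of s] by simp
  next
    fix x assume x: "t \<le> x" "x \<le> b"
    have "integral {t..x} v = integral {t..x} u"
      using x st by (intro integral_cong) (auto simp: v_def)
    thus "e x - d x = e t - d t"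
      using step [of t x] x st by simp
  qed
qed

lemma admissible_affine:
  assumes "a \<le> b" "0 \<le> m" "m \<le> 1 - \<xi>"
  shows "admissible \<xi> a d0 b (\<lambda>t. d0 + m * (t - a))"
  unfolding admissible_def using assms by (intro conjI exI [of _ "\<lambda>_. m"]) auto

section \<open>Draw-down profiles from a fixed starting point\<close>

locale drawdown = gbm +
  fixes \<xi> a d0 :: real
  assumes xi: "0 \<le> \<xi>" "\<xi> \<le> 1" and d0_nonneg: "0 \<le> d0" and start_pos: "\<alpha> * (a - d0) + \<beta> > 0"
begin

abbreviation adm where "adm \<equiv> admissible \<xi> a d0"
abbreviation dmax where "dmax \<equiv> max_slope_profile \<xi> a d0"
abbreviation J where "J \<equiv> cost \<alpha> \<beta> \<epsilon> q a"

lemma adm_dmax: "a \<le> b \<Longrightarrow> adm b dmax"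
  using admissible_affine [of a b "1 - \<xi>" \<xi> d0] xi by (simp add: max_slope_profile_def [abs_def])

text \<open>As the slope of d is at most 1, t - d t never falls below its initial value a - d0, so
  \<open>start_pos\<close> keeps the whole lower path in the state space.\<close>

lemma adm_bounds:
  assumes "adm b d" "a \<le> t" "t \<le> b"
  shows "d0 \<le> d t" "d t \<le> dmax t" "a - d0 \<le> t - d t" "shift (t - d t) > 0"
proof -
  have s: "d a = d0" using admissible_start [OF assms(1)] .
  have *: "d a \<le> d t" "d t \<le> d a + (1 - \<xi>) * (t - a)"
    using admissible_increment [OF assms(1) order_refl assms(2,3)] by auto
  from * show "d0 \<le> d t" "d t \<le> dmax t" by (auto simp: s max_slope_profile_def)
  have "(1 - \<xi>) * (t - a) \<le> 1 * (t - a)" using assms xi by (intro mult_right_mono) auto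
  thus **: "a - d0 \<le> t - d t" using * s by simp
  have "shift (a - d0) > 0" using start_pos shift_pos_iff by blast
  thus "shift (t - d t) > 0" using ** by simp
qed

text \<open>The slope bound, read backwards from b, leaves no room below \<open>dmax\<close>. This
  reduces uniqueness to the end point.\<close>

lemma adm_eq_dmax:
  assumes "adm b d" "d b = dmax b" "t \<in> {a..b}"
  shows "d t = dmax t"
proof -
  have "d b \<le> d t + (1 - \<xi>) * (b - t)"
    using admissible_increment [OF assms(1), of t b] assms by auto
  hence "dmax t \<le> d t" using assms(2) by (simp add: max_slope_profile_def algebra_simps)
  thus ?thesis using adm_bounds(2) [OF assms(1)] assms(3) by force
qed

lemma terminal_less:
  assumes "shift (b - \<delta>') > 0" "0 < \<delta>" "\<delta> < \<delta>'"
  shows "ln (\<nu> b (b - \<delta>')) < ln (\<nu> b (b - \<delta>))"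
  using nu_strict_mono [of "b - \<delta>'" "b - \<delta>" b] nu_pos [of "b - \<delta>'" b] assms by simp

text \<open>\<open>\<nu>\<close> increases in its second argument, so a deeper draw-down is cheaper
  at every time. Strictness comes from the terminal term, and finiteness of the cost keeps it from
  being absorbed by an infinite running cost.\<close>

lemma cost_mono:
  assumes d: "adm b d" and e: "adm b e" and le: "\<And>t. t \<in> {a..b} \<Longrightarrow> d t \<le> e t"
  shows "J b e \<le> J b d"
    and "J b e = J b d \<Longrightarrow> J b d < \<infinity> \<Longrightarrow> d b = e b"
proof -
  define I where "I d = (\<integral>\<^sup>+t\<in>{a..b}. (if d t > 0 then ennreal (\<nu> t (t - d t)) else \<infinity>) \<partial>lborel)" for d
  define T where "T d = (if d b > 0 then ereal (ln (\<nu> b (b - d b))) else \<infinity>)" for d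
  have J: "J b d = enn2ereal (I d) + T d" for d
    by (simp add: cost_def I_def T_def)
  have ab: "a \<le> b" using admissible_le d by blast
  have "I e \<le> I d"
    unfolding I_def
  proof (intro nn_integral_mono)
    fix t :: real
    have "\<nu> t (t - e t) \<le> \<nu> t (t - d t)" if "t \<in> {a..b}" "d t > 0"
      using adm_bounds(4) [OF e, of t] le that by (intro nu_mono) auto
    thus "(if 0 < e t then ennreal (\<nu> t (t - e t)) else \<infinity>) * indicator {a..b} t
       \<le> (if 0 < d t then ennreal (\<nu> t (t - d t)) else \<infinity>) * indicator {a..b} t"
      using le [of t] by (auto simp: indicator_def intro: ennreal_leI)
  qed
  hence I: "enn2ereal (I e) \<le> enn2ereal (I d)" by (simp add: less_eq_ennreal.rep_eq)
  have lt: "T e < T d" if "0 < d b" "d b < e b"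
    using terminal_less [of b "e b" "d b"] adm_bounds(4) [OF e ab] that by (simp add: T_def)
  have T: "T e \<le> T d"
    using lt le [of b] ab by (cases "d b = e b"; cases "d b > 0") (auto simp: T_def)
  show "J b e \<le> J b d" unfolding J by (intro add_mono I T)
  assume eq: "J b e = J b d" and fin: "J b d < \<infinity>"
  have I0: "enn2ereal (I d) \<ge> 0" "enn2ereal (I e) \<ge> 0" by simp_all
  have Tfin: "T d \<noteq> \<infinity>" "T d \<noteq> -\<infinity>" "T e \<noteq> -\<infinity>" "enn2ereal (I d) \<noteq> \<infinity>"
    using fin unfolding J by (auto simp: T_def split: if_splits)
  hence pos: "d b > 0" by (auto simp: T_def split: if_splits)
  show "d b = e b"
  proof (rule ccontr)
    assume "d b \<noteq> e b"
    hence "d b < e b" using le [of b] ab by auto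
    hence "T e < T d" using lt pos by blast
    hence "J b e < J b d"
      unfolding J using I I0 Tfin by (cases "enn2ereal (I d)"; cases "enn2ereal (I e)"; cases "T d"; cases "T e") auto
    thus False using eq by simp
  qed
qed

end

section \<open>Finite cost, first variation and the constant profile\<close>

context drawdown
begin

text \<open>From zero draw-down, slopes at most 1 keep t - d t at or above a, so the running cost
  dominates the integral of \<open>\<nu> t a\<close>, the derivative of ln W. As W vanishes at a,
  that integral diverges.\<close>

lemma cost_finite_start:
  assumes d: "adm b d" and ab: "a < b" and fin: "J b d < \<infinity>"
  shows "d0 > 0"
proof (rule ccontr)
  assume "\<not> d0 > 0"
  hence d0: "d0 = 0" using d0_nonneg by simp
  have sa: "shift a > 0" using start_pos d0 shift_pos_iff by simp
  define I where "I = (\<integral>\<^sup>+t\<in>{a..b}. (if d t > 0 then ennreal (\<nu> t (t - d t)) else \<infinity>) \<partial>lborel)"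
  have "enn2ereal I \<noteq> \<infinity>"
    using fin unfolding cost_def I_def [symmetric] by (auto split: if_splits)
  hence "I \<noteq> top" by auto
  then obtain C where C: "I = ennreal C" "C \<ge> 0"
    by (cases I) auto
  define W where "W t = scale_W \<alpha> \<beta> \<epsilon> q t a" for t
  obtain W' where W': "\<And>t. \<alpha> * t + \<beta> > 0 \<Longrightarrow> (W has_real_derivative W' t) (at t)"
    using scale_W_generator [OF alpha_pos eps_pos q_pos] sa unfolding shift_pos_iff [symmetric] W_def [abs_def]
    by metis
  have Wpos: "W t > 0" if "t > a" for t
    unfolding W_def scale_W_def using that sa ln_ratio_eq [of t a]
    by (intro omega_pos alpha_pos eps_pos q_pos) auto
  have "isCont W a" using W' [of a] sa shift_pos_iff [of a] DERIV_isCont by blast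
  hence "(W \<longlongrightarrow> W a) (at_right a)"
    by (simp add: continuous_at tendsto_within_subset isCont_def filterlim_at_split)
  moreover have "W a = 0" using sa unfolding W_def scale_W_def omega_def
    by (simp add: affine_eq_shift)
  ultimately have "(W \<longlongrightarrow> 0) (at_right a)" by simp
  \<comment> \<open>Below this threshold for W s, the increment of ln W over [s, b] exceeds C + 1,
    whereas the running cost is C.\<close>
  moreover have "exp (ln (W b) - C - 1) > 0" by simp
  ultimately have "eventually (\<lambda>t. W t < exp (ln (W b) - C - 1)) (at_right a)"
    by (rule order_tendstoD(2))
  moreover have "eventually (\<lambda>t. t \<in> {a<..<b}) (at_right a)"
    using ab by (rule eventually_at_right_real)
  ultimately have "eventually (\<lambda>t. W t < exp (ln (W b) - C - 1) \<and> t \<in> {a<..<b}) (at_right a)"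
    by (rule eventually_conj)
  then obtain s where s: "W s < exp (ln (W b) - C - 1)" "a < s" "s < b"
    using eventually_happens [of _ "at_right a"] by (auto simp: trivial_limit_at_right_real)
  hence lnW: "ln (W s) < ln (W b) - C - 1"
    using Wpos [of s] by (metis exp_less_cancel_iff exp_ln)
  have hi: "((\<lambda>t. \<nu> t a) has_integral ln (W b) - ln (W s)) {s..b}"
  proof (rule fundamental_theorem_of_calculus)
    fix t assume "t \<in> {s..b}"
    hence "((\<lambda>t. ln (W t)) has_real_derivative \<nu> t a) (at t)"
      unfolding W_def using s sa by (intro nu_log_derivative alpha_pos eps_pos q_pos) (auto simp: shift_pos_iff)
    thus "((\<lambda>t. ln (W t)) has_vector_derivative \<nu> t a) (at t within {s..b})"
      using has_real_derivative_iff_has_vector_derivative has_vector_derivative_at_within by blast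
  qed (use s in auto)
  have "ennreal (ln (W b) - ln (W s)) = integral\<^sup>N lborel (\<lambda>t. ennreal (\<nu> t a) * indicator {s..b} t)"
    using nu_pos [of a] sa s by (intro nn_integral_has_integral_lebesgue' [OF _ hi, symmetric]) (auto intro: less_imp_le)
  also have "\<dots> \<le> I"
    unfolding I_def
  proof (intro nn_integral_mono)
    fix t :: real
    show "ennreal (\<nu> t a) * indicator {s..b} t
       \<le> (if 0 < d t then ennreal (\<nu> t (t - d t)) else \<infinity>) * indicator {a..b} t"
    proof (cases "t \<in> {s..b} \<and> d t > 0")
      case True
      hence "\<nu> t a \<le> \<nu> t (t - d t)"
        using adm_bounds(3) [OF d, of t] d0 s sa by (intro nu_mono) auto
      thus ?thesis using True s by (auto intro: ennreal_leI)
    qed (use s in \<open>auto simp: indicator_def\<close>)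
  qed
  finally have "ennreal (ln (W b) - ln (W s)) \<le> ennreal C" using C by simp
  hence "ln (W b) - ln (W s) \<le> C" using C(2) by (simp add: ennreal_le_iff)
  thus False using lnW by simp
qed

lemma continuous_on_path:
  assumes d0: "d0 > 0" and d: "adm b d"
  shows "continuous_on {a..b} (\<lambda>t. \<nu> t (t - d t))" "continuous_on {a..b} (\<lambda>t. d2\<nu> t (t - d t))"
proof -
  have *: "shift (t - d t) > 0 \<and> t - d t < t" if "t \<in> {a..b}" for t
    using adm_bounds [OF d, of t] that d0 by auto
  show "continuous_on {a..b} (\<lambda>t. \<nu> t (t - d t))" "continuous_on {a..b} (\<lambda>t. d2\<nu> t (t - d t))"
    using * by (auto intro!: continuous_on_nu continuous_on_d2_nu continuous_intros admissible_continuous [OF d])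
qed

lemma cost_eq:
  assumes d0: "d0 > 0" and d: "adm b d"
  shows "J b d = ereal (integral {a..b} (\<lambda>t. \<nu> t (t - d t)) + ln (\<nu> b (b - d b)))"
proof -
  have pos: "\<nu> t (t - d t) \<ge> 0" if "t \<in> {a..b}" for t
    using nu_pos [of "t - d t" t] adm_bounds [OF d, of t] that d0 by auto
  have hi: "((\<lambda>t. \<nu> t (t - d t)) has_integral integral {a..b} (\<lambda>t. \<nu> t (t - d t))) {a..b}"
    using continuous_on_path [OF assms] integrable_continuous_real by blast
  have "ennreal (integral {a..b} (\<lambda>t. \<nu> t (t - d t)))
      = integral\<^sup>N lborel (\<lambda>t. ennreal (\<nu> t (t - d t)) * indicator {a..b} t)"
    using pos by (intro nn_integral_has_integral_lebesgue' [OF _ hi, symmetric])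
  also have "\<dots> = (\<integral>\<^sup>+t\<in>{a..b}. (if d t > 0 then ennreal (\<nu> t (t - d t)) else \<infinity>) \<partial>lborel)"
  proof (intro nn_integral_cong)
    fix t :: real
    show "ennreal (\<nu> t (t - d t)) * indicator {a..b} t = (if 0 < d t then ennreal (\<nu> t (t - d t)) else \<infinity>) * indicator {a..b} t"
      using adm_bounds(1) [OF d, of t] d0 by (auto simp: indicator_def)
  qed
  finally have "(\<integral>\<^sup>+t\<in>{a..b}. (if d t > 0 then ennreal (\<nu> t (t - d t)) else \<infinity>) \<partial>lborel)
      = ennreal (integral {a..b} (\<lambda>t. \<nu> t (t - d t)))" by simp
  moreover have "integral {a..b} (\<lambda>t. \<nu> t (t - d t)) \<ge> 0"
    using has_integral_nonneg [OF hi] pos by blast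
  moreover have "d b > 0" using adm_bounds(1) [OF d admissible_le [OF d]] d0 by simp
  ultimately show ?thesis unfolding cost_def by (simp add: enn2ereal_ennreal)
qed

text \<open>The left side is minus the right derivative at w = 0 of the cost along the segment from
  d to e; the sign appears because t - d t moves against d. Minimality at w = 0 makes that
  derivative nonnegative.\<close>

lemma first_variation:
  assumes d0: "d0 > 0" and d: "adm b d" and e: "adm b e"
    and opt: "\<And>w. 0 \<le> w \<Longrightarrow> w \<le> 1 \<Longrightarrow> J b d \<le> J b (\<lambda>t. d t + w * (e t - d t))"
  shows "integral {a..b} (\<lambda>t. d2\<nu> t (t - d t) * (e t - d t))
         + d2\<nu> b (b - d b) / \<nu> b (b - d b) * (e b - d b) \<le> 0"
proof -
  define h where "h t = e t - d t" for t
  define P where "P w t = t - (d t + w * h t)" for w t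
  have ab: "a \<le> b" using admissible_le d by blast
  have adm: "adm b (\<lambda>t. d t + w * h t)" if "w \<in> {0..1}" for w
    using admissible_convex [OF d e, of w] that by (simp add: h_def)
  have P: "shift (P w t) > 0 \<and> P w t < t" if "w \<in> {0..1}" "t \<in> {a..b}" for w t
    using adm_bounds [OF adm [OF that(1)], of t] that d0 by (auto simp: P_def)
  have P': "((\<lambda>w. \<nu> t (P w t)) has_real_derivative - (d2\<nu> t (P w t) * h t)) (at w within {0..1})"
    if "w \<in> {0..1}" "t \<in> {a..b}" for w t
  proof -
    have "(\<nu> t has_real_derivative d2\<nu> t (P w t)) (at (P w t))"
      using P [OF that] shift_pos_iff by (intro d2_nu_has_derivative alpha_pos eps_pos q_pos) auto
    moreover have "((\<lambda>w. P w t) has_real_derivative - h t) (at w)"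
      unfolding P_def by (auto intro!: derivative_eq_intros)
    ultimately have "((\<lambda>w. \<nu> t (P w t)) has_real_derivative d2\<nu> t (P w t) * - h t) (at w)"
      by (rule DERIV_chain2)
    thus ?thesis by (simp add: has_field_derivative_at_within)
  qed
  have hc: "continuous_on {a..b} h"
    unfolding h_def using admissible_continuous d e by (intro continuous_intros) auto
  define \<phi> where "\<phi> w = integral {a..b} (\<lambda>t. \<nu> t (P w t)) + ln (\<nu> b (P w b))" for w
  have J: "J b (\<lambda>t. d t + w * h t) = ereal (\<phi> w)" if "w \<in> {0..1}" for w
    using cost_eq [OF d0 adm [OF that]] by (simp add: \<phi>_def P_def)
  have "((\<lambda>w. integral (cbox a b) (\<lambda>t. \<nu> t (P w t))) has_real_derivative
      integral (cbox a b) (\<lambda>t. - (d2\<nu> t (P 0 t) * h t))) (at 0 within {0..1})"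
  proof (rule leibniz_rule_field_derivative)
    show "(\<lambda>t. \<nu> t (P w t)) integrable_on cbox a b" if "w \<in> {0..1}" for w
      using continuous_on_path(1) [OF d0 adm [OF that]] integrable_continuous_real by (simp add: P_def)
    have hc': "continuous_on ({0..1} \<times> cbox a b) (\<lambda>x. h (snd x))"
      using hc by (intro continuous_on_compose2 [OF hc] continuous_intros) auto
    have dc': "continuous_on ({0..1} \<times> cbox a b) (\<lambda>x. d (snd x))"
      using hc by (intro continuous_on_compose2 [OF admissible_continuous [OF d]] continuous_intros) auto
    have "continuous_on ({0..1} \<times> cbox a b) (\<lambda>x. - (d2\<nu> (snd x) (P (fst x) (snd x)) * h (snd x)))"
    proof (intro continuous_intros hc' continuous_on_d2_nu)
      show "continuous_on ({0..1} \<times> cbox a b) (\<lambda>x. P (fst x) (snd x))"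
        unfolding P_def by (intro continuous_intros hc' dc')
    qed (use P in auto)
    thus "continuous_on ({0..1} \<times> cbox a b) (\<lambda>(w, t). - (d2\<nu> t (P w t) * h t))"
      by (simp add: case_prod_beta)
  qed (use P' in auto)
  moreover have "((\<lambda>w. ln (\<nu> b (P w b))) has_real_derivative - (d2\<nu> b (P 0 b) * h b) / \<nu> b (P 0 b)) (at 0 within {0..1})"
    using P' [of 0 b] nu_pos [of "P 0 b" b] P [of 0 b] ab
    by (auto intro!: derivative_eq_intros)
  ultimately have \<phi>': "(\<phi> has_real_derivative integral {a..b} (\<lambda>t. - (d2\<nu> t (P 0 t) * h t))
      + - (d2\<nu> b (P 0 b) * h b) / \<nu> b (P 0 b)) (at 0 within {0..1})"
    unfolding \<phi>_def [abs_def] by (intro DERIV_add) auto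
  have "\<not> (integral {a..b} (\<lambda>t. - (d2\<nu> t (P 0 t) * h t)) + - (d2\<nu> b (P 0 b) * h b) / \<nu> b (P 0 b) < 0)"
  proof
    assume "integral {a..b} (\<lambda>t. - (d2\<nu> t (P 0 t) * h t)) + - (d2\<nu> b (P 0 b) * h b) / \<nu> b (P 0 b) < 0"
    then obtain \<eta> where \<eta>: "\<eta> > 0" "\<And>w. w > 0 \<Longrightarrow> 0 + w \<in> {0..1} \<Longrightarrow> w < \<eta> \<Longrightarrow> \<phi> (0 + w) < \<phi> 0"
      using has_real_derivative_neg_dec_right [OF \<phi>'] by blast
    define w where "w = min 1 (\<eta> / 2)"
    have w: "0 < w" "w \<le> 1" "w < \<eta>" using \<eta>(1) by (auto simp: w_def)
    hence "\<phi> w < \<phi> 0" using \<eta>(2) [of w] by simp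
    moreover have "\<phi> 0 \<le> \<phi> w"
      using opt [of w] w J [of w] J [of 0] by (simp add: h_def)
    ultimately show False by simp
  qed
  moreover have "P 0 t = t - d t" for t by (simp add: P_def)
  ultimately show ?thesis
    by (simp add: h_def)
qed

text \<open>A constant profile has the least area for its b, so no competitor on the same interval
  reduces the area and the separating line could be vertical. Moving b helps: the terminal cost
  falls at first order, while the running cost does not rise, as the interval shrinks and the
  draw-down grows.\<close>

lemma constant_improvable:
  assumes d0: "d0 > 0" and M: "\<xi> < 1" and ab: "a < b" and d: "adm b d" and const: "d b = d0"
  obtains b' e where "adm b' e" "integral {a..b'} e \<le> integral {a..b} d" "J b' e < J b d"
proof -
  have dc: "d t = d0" if "t \<in> {a..b}" for t
    using admissible_increment(1) [OF d, of t b] adm_bounds(1) [OF d, of t] const that by auto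
  define M where "M = 1 - \<xi>"
  have Mp: "0 < M" "M \<le> 1" using M xi by (auto simp: M_def)
  \<comment> \<open>Stopping \<open>\<kappa> * \<sigma>\<^sup>2\<close> earlier pays for the extra area of a steep final stretch of length \<open>\<sigma>\<close>,
    while its effect on the cost is of second order in \<open>\<sigma>\<close>.\<close>
  define \<kappa> where "\<kappa> = M / (2 * d0)"
  have kp: "\<kappa> > 0" using Mp d0 by (simp add: \<kappa>_def)
  define X Y where "X = shift b" and "Y = shift (b - d0)"
  have XY: "0 < Y" "Y < X"
    using adm_bounds(4) [OF d, of b] ab const d0 by (auto simp: X_def Y_def)
  define z where "z = ln X - ln Y"
  have z: "z > 0" using XY by (simp add: z_def)
  \<comment> \<open>The terminal cost at the new end: X and Y both lose
    \<open>\<kappa> * \<sigma>\<^sup>2\<close> and Y loses \<open>M * \<sigma>\<close> more; only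
    the latter contributes to the derivative at 0.\<close>
  define \<psi> where "\<psi> \<sigma> = ln (\<mu> (ln (X - \<kappa> * \<sigma>\<^sup>2) - ln (Y - \<kappa> * \<sigma>\<^sup>2 - M * \<sigma>))) - ln (X - \<kappa> * \<sigma>\<^sup>2)" for \<sigma>
  define S where "S = (k / (2 * sinh (k * z / 2)))\<^sup>2"
  have S: "S > 0" using k_pos z by (simp add: S_def)
  have "((\<lambda>\<sigma>. ln (X - \<kappa> * \<sigma>\<^sup>2) - ln (Y - \<kappa> * \<sigma>\<^sup>2 - M * \<sigma>)) has_real_derivative M / Y) (at 0)"
    using XY by (auto intro!: derivative_eq_intros)
  moreover have "(\<mu> has_real_derivative - S) (at (ln (X - \<kappa> * 0\<^sup>2) - ln (Y - \<kappa> * 0\<^sup>2 - M * 0)))"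
    using mu_derivative [OF z] by (simp add: z_def S_def)
  ultimately have "((\<lambda>\<sigma>. \<mu> (ln (X - \<kappa> * \<sigma>\<^sup>2) - ln (Y - \<kappa> * \<sigma>\<^sup>2 - M * \<sigma>))) has_real_derivative - S * (M / Y)) (at 0)"
    by (intro DERIV_chain2)
  hence "(\<psi> has_real_derivative - S * (M / Y) / \<mu> z) (at 0)"
    unfolding \<psi>_def [abs_def] using mu_pos [OF z] XY
    by (auto intro!: derivative_eq_intros simp: z_def)
  moreover have "- S * (M / Y) / \<mu> z < 0"
    using S Mp XY mu_pos [OF z] by (simp add: divide_neg_pos)
  ultimately obtain \<eta> where \<eta>: "\<eta> > 0" "\<And>\<sigma>. \<sigma> > 0 \<Longrightarrow> \<sigma> < \<eta> \<Longrightarrow> \<psi> (0 + \<sigma>) < \<psi> 0"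
    using DERIV_neg_dec_right by blast
  \<comment> \<open>The bounds ensure, in turn, that \<open>\<psi>\<close> has decreased, that
    \<open>\<sigma>\<^sup>2 \<le> \<sigma>\<close>, and that the cut and the steep stretch fit into
    [a, b].\<close>
  define \<sigma> where "\<sigma> = min (\<eta> / 2) (min 1 ((b - a) / (\<kappa> + 1)))"
  have \<sigma>: "0 < \<sigma>" "\<sigma> < \<eta>" "\<sigma> \<le> 1" "\<sigma> \<le> (b - a) / (\<kappa> + 1)"
    using \<eta>(1) ab kp by (auto simp: \<sigma>_def)
  have "\<kappa> * \<sigma>\<^sup>2 + \<sigma> \<le> \<sigma> * (\<kappa> + 1)"
    using \<sigma> kp by (simp add: power2_eq_square algebra_simps mult_left_le mult_left_le_one_le)
  also have "\<dots> \<le> b - a" using \<sigma>(4) kp by (simp add: field_simps)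
  finally have room: "\<kappa> * \<sigma>\<^sup>2 + \<sigma> \<le> b - a" .
  define b' s where "b' = b - \<kappa> * \<sigma>\<^sup>2" and "s = b' - \<sigma>"
  have b': "a \<le> s" "s \<le> b'" "b' \<le> b" "a \<le> b'"
    using room \<sigma> kp by (auto simp: b'_def s_def)
  have c: "adm b' (\<lambda>t. d0)"
    using admissible_affine [of a b' 0 \<xi> d0] b' xi by simp
  obtain e where e: "adm b' e" "\<And>x. a \<le> x \<Longrightarrow> x \<le> s \<Longrightarrow> e x = d0"
    "\<And>x. s \<le> x \<Longrightarrow> x \<le> b' \<Longrightarrow> e x = d0 + M * (x - s)"
    using admissible_modify [OF c, of s b' M] b' Mp by (auto simp: M_def)
  have "integral {a..b'} e = integral {a..s} e + integral {s..b'} e"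
    using b' admissible_continuous [OF e(1)] integrable_continuous_real
    by (intro Henstock_Kurzweil_Integration.integral_combine [symmetric]) auto
  also have "integral {a..s} e = integral {a..s} (\<lambda>_. d0)"
    using e(2) by (intro integral_cong) auto
  also have "integral {s..b'} e = integral {s..b'} (\<lambda>x. d0 + M * (x - s))"
    using e(3) by (intro integral_cong) auto
  also have "\<dots> = (d0 * b' + M * (b' - s)\<^sup>2 / 2) - (d0 * s + M * (s - s)\<^sup>2 / 2)"
    using b' by (intro integral_unique fundamental_theorem_of_calculus)
       (auto intro!: derivative_eq_intros simp flip: has_real_derivative_iff_has_vector_derivative)
  also have "integral {a..s} (\<lambda>_. d0) + \<dots> = d0 * (b' - a) + M * \<sigma>\<^sup>2 / 2"
    using b' by (simp add: s_def algebra_simps)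
  \<comment> \<open>The triangle above level d0, of area \<open>M * \<sigma>\<^sup>2 / 2\<close>,
    matches the strip \<open>d0 * \<kappa> * \<sigma>\<^sup>2\<close> that was cut off.\<close>
  also have "\<dots> = d0 * (b - a)"
    using d0 by (simp add: b'_def \<kappa>_def field_simps)
  also have "\<dots> = integral {a..b} (\<lambda>_. d0)" using ab by simp
  also have "\<dots> = integral {a..b} d" using dc by (intro integral_cong) auto
  finally have area: "integral {a..b'} e = integral {a..b} d" .
  have eb: "e b' = d0 + M * \<sigma>" using e(3) [of b'] b' by (simp add: s_def)
  have "integral {a..b'} (\<lambda>t. \<nu> t (t - e t)) \<le> integral {a..b'} (\<lambda>t. \<nu> t (t - d0))"
  proof (rule integral_le)
    show "(\<lambda>t. \<nu> t (t - e t)) integrable_on {a..b'}"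
      using continuous_on_path(1) [OF d0 e(1)] integrable_continuous_real by blast
    show "(\<lambda>t. \<nu> t (t - d0)) integrable_on {a..b'}"
      using continuous_on_path(1) [OF d0 c] integrable_continuous_real by blast
    show "\<nu> t (t - e t) \<le> \<nu> t (t - d0)" if "t \<in> {a..b'}" for t
      using adm_bounds [OF e(1), of t] that d0 by (intro nu_mono) auto
  qed
  also have "\<dots> \<le> integral {a..b} (\<lambda>t. \<nu> t (t - d0))"
  proof (rule integral_subset_le)
    have cb: "adm b (\<lambda>t. d0)"
      using admissible_affine [of a b 0 \<xi> d0] ab xi by simp
    show "(\<lambda>t. \<nu> t (t - d0)) integrable_on {a..b}"
      using continuous_on_path(1) [OF d0 cb] integrable_continuous_real by blast
    show "(\<lambda>t. \<nu> t (t - d0)) integrable_on {a..b'}"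
      using continuous_on_path(1) [OF d0 c] integrable_continuous_real by blast
    show "\<forall>t\<in>{a..b}. 0 \<le> \<nu> t (t - d0)"
      using nu_pos [of "t - d0" t for t] adm_bounds(4) [OF cb] d0 by (auto intro: less_imp_le)
  qed (use b' in auto)
  also have "\<dots> = integral {a..b} (\<lambda>t. \<nu> t (t - d t))"
    using dc by (intro integral_cong) auto
  finally have run: "integral {a..b'} (\<lambda>t. \<nu> t (t - e t)) \<le> integral {a..b} (\<lambda>t. \<nu> t (t - d t))" .
  have "ln (\<nu> b' (b' - e b')) = \<psi> \<sigma>"
  proof -
    have pos: "shift (b' - e b') > 0" "b' - e b' < b'"
      using adm_bounds [OF e(1), of b'] b' d0 by auto
    hence "\<nu> b' (b' - e b') = \<mu> (ln (shift b') - ln (shift (b' - e b'))) / shift b'"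
      by (intro nu_eq) auto
    moreover have "shift b' = X - \<kappa> * \<sigma>\<^sup>2" "shift (b' - e b') = Y - \<kappa> * \<sigma>\<^sup>2 - M * \<sigma>"
      unfolding eb by (simp_all add: X_def Y_def b'_def)
    moreover have "shift b' > 0" "\<mu> (ln (shift b') - ln (shift (b' - e b'))) > 0"
      using pos by (auto intro!: mu_pos)
    ultimately show ?thesis unfolding \<psi>_def by (simp add: ln_div)
  qed
  also have "\<dots> < \<psi> 0" using \<eta>(2) [of \<sigma>] \<sigma> by simp
  also have "\<psi> 0 = ln (\<nu> b (b - d b))"
    using XY mu_pos [OF z] nu_eq [of b "b - d b"] const
    by (simp add: \<psi>_def X_def Y_def z_def ln_div)
  finally have "J b' e < J b d"
    unfolding cost_eq [OF d0 e(1)] cost_eq [OF d0 d] using run by simp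
  thus ?thesis using that [OF e(1)] area by simp
qed

end

section \<open>Sign patterns of real functions\<close>

lemma piecewise_refl: "piecewise P a a"
  unfolding piecewise_def by (rule exI [of _ 0], rule exI [of _ "\<lambda>_. a"]) simp

text \<open>An empty last piece is allowed, so coinciding break points need no case distinction
  later.\<close>

lemma piecewise_snoc:
  assumes "piecewise P a b" "b \<le> c" "b < c \<Longrightarrow> P b c"
  shows "piecewise P a c"
proof (cases "b = c")
  case False
  from assms(1) obtain n \<tau> where \<tau>: "\<tau> 0 = a" "\<tau> n = b" "\<forall>i<n. \<tau> i < \<tau> (Suc i) \<and> P (\<tau> i) (\<tau> (Suc i))"
    unfolding piecewise_def by blast
  define \<tau>' where "\<tau>' = \<tau>(Suc n := c)"
  have "\<tau>' 0 = a \<and> \<tau>' (Suc n) = c \<and> (\<forall>i<Suc n. \<tau>' i < \<tau>' (Suc i) \<and> P (\<tau>' i) (\<tau>' (Suc i)))"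
    using \<tau> assms(2,3) False by (auto simp: \<tau>'_def less_Suc_eq)
  thus ?thesis unfolding piecewise_def by blast
qed (use assms in simp)

lemma piecewise_single: "a \<le> b \<Longrightarrow> (a < b \<Longrightarrow> P a b) \<Longrightarrow> piecewise P a b"
  by (rule piecewise_snoc [OF piecewise_refl])

lemma piecewise_mono:
  assumes "piecewise P a b" and PQ: "\<And>s t. a \<le> s \<Longrightarrow> s < t \<Longrightarrow> t \<le> b \<Longrightarrow> P s t \<Longrightarrow> Q s t"
  shows "piecewise Q a b"
proof -
  from assms(1) obtain n \<tau> where \<tau>: "\<tau> 0 = a" "\<tau> n = b" "\<forall>i<n. \<tau> i < \<tau> (Suc i) \<and> P (\<tau> i) (\<tau> (Suc i))"
    unfolding piecewise_def by blast
  have mono: "\<tau> i \<le> \<tau> j" if "i \<le> j" "j \<le> n" for i j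
    using that
  proof (induction j rule: dec_induct)
    case (step j)
    hence "\<tau> j < \<tau> (Suc j)" using \<tau>(3) by simp
    with step show ?case by simp
  qed simp
  have "Q (\<tau> i) (\<tau> (Suc i))" if "i < n" for i
  proof (rule PQ)
    show "a \<le> \<tau> i" "\<tau> (Suc i) \<le> b"
      using mono [of 0 i] mono [of "Suc i" n] that \<tau>(1,2) by simp_all
  qed (use \<tau>(3) that in auto)
  thus ?thesis unfolding piecewise_def using \<tau> by (intro exI [of _ n] exI [of _ \<tau>]) simp
qed

text \<open>The interval is open because the costate vanishes at the ends of arcs between its zeros;
  for \<open>s \<ge> t\<close> the property is vacuous, which lets degenerate pieces pass.\<close>

definition const_sign :: "(real \<Rightarrow> real) \<Rightarrow> real \<Rightarrow> real \<Rightarrow> bool" where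
  "const_sign p s t \<longleftrightarrow> (\<forall>x\<in>{s<..<t}. p x < 0) \<or> (\<forall>x\<in>{s<..<t}. p x > 0) \<or> (\<forall>x\<in>{s<..<t}. p x = 0)"

lemma same_sign:
  fixes p :: "real \<Rightarrow> real"
  assumes cont: "continuous_on S p" and S: "is_interval S" and nz: "\<And>x. x \<in> S \<Longrightarrow> p x \<noteq> 0"
    and xy: "x \<in> S" "y \<in> S" "p x < 0"
  shows "p y < 0"
proof (rule ccontr)
  assume "\<not> p y < 0"
  hence "p y > 0" using nz [OF xy(2)] by simp
  moreover have "is_interval (p ` S)"
    using connected_continuous_image [OF cont] S is_interval_connected_1 by blast
  ultimately have "0 \<in> p ` S"
    using xy by (meson imageI less_imp_le mem_is_interval_1_I)
  thus False using nz by auto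
qed

lemma const_sign_nonzero:
  assumes cont: "continuous_on {s<..<t} p" and nz: "\<And>x. x \<in> {s<..<t} \<Longrightarrow> p x \<noteq> 0"
  shows "const_sign p s t"
proof (cases "\<exists>x\<in>{s<..<t}. p x < 0")
  case True
  then obtain x where "x \<in> {s<..<t}" "p x < 0" by blast
  hence "p y < 0" if "y \<in> {s<..<t}" for y
    using same_sign [OF cont is_interval_oo nz \<open>x \<in> _\<close> that \<open>p x < 0\<close>] by simp
  thus ?thesis by (simp add: const_sign_def)
next
  case False
  hence "p x > 0" if "x \<in> {s<..<t}" for x
    using nz [OF that] that by (meson not_less_iff_gr_or_eq)
  thus ?thesis by (simp add: const_sign_def)
qed

lemma zero_set_bounds:
  fixes p :: "real \<Rightarrow> real"
  assumes cont: "continuous_on {l..u} p" and z: "z \<in> {l..u}" "p z = 0"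
  obtains s t where "l \<le> s" "s \<le> t" "t \<le> u" "p s = 0" "p t = 0"
    "\<And>x. l \<le> x \<Longrightarrow> x < s \<Longrightarrow> p x \<noteq> 0" "\<And>x. t < x \<Longrightarrow> x \<le> u \<Longrightarrow> p x \<noteq> 0"
proof -
  define Z where "Z = {x \<in> {l..u}. p x = 0}"
  have "closed Z" unfolding Z_def using cont by (intro continuous_closed_preimage_constant) auto
  moreover have "bounded Z" by (rule bounded_subset [of "{l..u}"]) (auto simp: Z_def)
  ultimately have Z: "compact Z" "Z \<noteq> {}" using z by (auto simp: compact_eq_bounded_closed Z_def)
  obtain s where s: "s \<in> Z" "\<And>x. x \<in> Z \<Longrightarrow> s \<le> x" using compact_attains_inf [OF Z] by blast
  obtain t where t: "t \<in> Z" "\<And>x. x \<in> Z \<Longrightarrow> x \<le> t" using compact_attains_sup [OF Z] by blast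
  show ?thesis
  proof (rule that [of s t])
    show "p x \<noteq> 0" if "l \<le> x" "x < s" for x
      using s(2) [of x] s(1) that by (auto simp: Z_def)
    show "p x \<noteq> 0" if "t < x" "x \<le> u" for x
      using t(2) [of x] t(1) that by (auto simp: Z_def)
  qed (use s(1) t(1) s(2) [OF t(1)] in \<open>auto simp: Z_def\<close>)
qed

text \<open>The bounds are the last zero before x and the first zero after it, both from
  \<open>zero_set_bounds\<close>.\<close>

lemma nonzero_component:
  fixes p :: "real \<Rightarrow> real"
  assumes cont: "continuous_on {l..u} p" and p: "p l = 0" "p u = 0" and x: "l < x" "x < u" "p x \<noteq> 0"
  obtains s t where "l \<le> s" "s < x" "x < t" "t \<le> u" "p s = 0" "p t = 0"
    "\<And>z. s < z \<Longrightarrow> z < t \<Longrightarrow> p z \<noteq> 0"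
proof -
  have c: "continuous_on {l..x} p" "continuous_on {x..u} p"
    using x by (auto intro: continuous_on_subset [OF cont])
  have "l \<in> {l..x}" "u \<in> {x..u}" using x by auto
  then obtain s s' t t' where "l \<le> s'" "s' \<le> s" "s \<le> x" "p s = 0" "\<And>z. s < z \<Longrightarrow> z \<le> x \<Longrightarrow> p z \<noteq> 0"
    and "x \<le> t" "t \<le> t'" "t' \<le> u" "p t = 0" "\<And>z. x \<le> z \<Longrightarrow> z < t \<Longrightarrow> p z \<noteq> 0"
    using zero_set_bounds [OF c(1) _ p(1)] zero_set_bounds [OF c(2) _ p(2)] by metis
  then have s: "l \<le> s" "s \<le> x" "p s = 0" "\<And>z. s < z \<Longrightarrow> z \<le> x \<Longrightarrow> p z \<noteq> 0"
    and t: "x \<le> t" "t \<le> u" "p t = 0" "\<And>z. x \<le> z \<Longrightarrow> z < t \<Longrightarrow> p z \<noteq> 0"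
    by (simp_all add: order_trans [of l s' s] order_trans [of t t' u])
  have "s \<noteq> x" "t \<noteq> x" using s(3) t(3) x(3) by auto
  moreover have "p z \<noteq> 0" if "s < z" "z < t" for z
    using s(4) [of z] t(4) [of z] that by linarith
  ultimately show ?thesis using s t by (intro that [of s t]) auto
qed

lemma mean_value_within:
  fixes p f :: "real \<Rightarrow> real"
  assumes der: "\<And>x. l \<le> x \<Longrightarrow> x \<le> u \<Longrightarrow> (p has_real_derivative f x) (at x within {l..u})"
    and xy: "l \<le> x" "x < y" "y \<le> u"
  shows "\<exists>z. x < z \<and> z < y \<and> p y - p x = (y - x) * f z"
proof -
  have "\<exists>z\<in>{x<..<y}. p y - p x = (\<lambda>h. h * f z) (y - x)"
  proof (rule mvt_simple [OF xy(2)])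
    fix z assume "x \<le> z" "z \<le> y"
    hence "(p has_real_derivative f z) (at z within {x..y})"
      using xy by (intro DERIV_subset [OF der]) auto
    thus "(p has_derivative (\<lambda>h. h * f z)) (at z within {x..y})"
      by (simp add: has_field_derivative_def mult_commute_abs)
  qed
  thus ?thesis by auto
qed

text \<open>A nonincreasing derivative makes p concave, so zero end values force p >= 0, and an
  interior zero beside a positive value would violate the order of chord slopes.\<close>

lemma const_sign_concave:
  fixes p f :: "real \<Rightarrow> real"
  assumes der: "\<And>x. l \<le> x \<Longrightarrow> x \<le> u \<Longrightarrow> (p has_real_derivative f x) (at x within {l..u})"
    and f: "\<And>x y. l \<le> x \<Longrightarrow> x \<le> y \<Longrightarrow> y \<le> u \<Longrightarrow> f y \<le> f x" and p: "p l = 0" "p u = 0"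
  shows "const_sign p l u"
proof -
  note mvt = mean_value_within [OF der]
  have nonneg: "p x \<ge> 0" if x: "l < x" "x < u" for x
  proof (rule ccontr)
    assume "\<not> p x \<ge> 0"
    obtain z1 z2 where z: "l < z1" "z1 < x" "p x - p l = (x - l) * f z1" "x < z2" "z2 < u" "p u - p x = (u - x) * f z2"
      using mvt [of l x] mvt [of x u] x by auto
    have "(x - l) * f z1 < 0" "(u - x) * f z2 > 0"
      using z(3,6) \<open>\<not> p x \<ge> 0\<close> p by linarith+
    hence "f z1 < 0" "f z2 > 0"
      using x by (simp_all add: mult_less_0_iff zero_less_mult_iff)
    thus False using f [of z1 z2] z by simp
  qed
  show ?thesis
  proof (cases "\<exists>x\<in>{l<..<u}. p x = 0")
    case True
    then obtain x where x: "l < x" "x < u" "p x = 0" by auto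
    have "p y = 0" if y: "l < y" "y < u" for y
    proof (rule ccontr)
      assume "p y \<noteq> 0"
      hence py: "p y > 0" using nonneg [OF y] by simp
      hence "y \<noteq> x" using x by auto
      then consider "y < x" | "x < y" by linarith
      thus False
      proof cases
        case 1
        obtain z1 z2 where z: "y < z1" "z1 < x" "p x - p y = (x - y) * f z1" "x < z2" "z2 < u" "p u - p x = (u - x) * f z2"
          using mvt [of y x] mvt [of x u] x y 1 by auto
        have "f z2 = 0" using z x p by simp
        moreover have "(x - y) * f z1 < 0" using z(3) py x(3) by linarith
        hence "f z1 < 0" using 1 by (simp add: mult_less_0_iff)
        ultimately show False using f [of z1 z2] z y by simp
      next
        case 2
        obtain z1 z2 where z: "x < z1" "z1 < y" "p y - p x = (y - x) * f z1" "l < z2" "z2 < x" "p x - p l = (x - l) * f z2"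
          using mvt [of x y] mvt [of l x] x y 2 by auto
        have "f z2 = 0" using z x p by simp
        moreover have "(y - x) * f z1 > 0" using z(3) py x(3) by linarith
        hence "f z1 > 0" using 2 by (simp add: zero_less_mult_iff)
        ultimately show False using f [of z2 z1] z y by simp
      qed
    qed
    thus ?thesis by (simp add: const_sign_def)
  next
    case False
    thus ?thesis using nonneg unfolding const_sign_def by (force simp: order_less_le)
  qed
qed

text \<open>Without positive arcs, p <= 0. A negative arc between zeros can only start at l itself,
  so p is at most one negative arc from l followed by zeros.\<close>

lemma const_sign_split:
  fixes p f :: "real \<Rightarrow> real"
  assumes cont: "continuous_on {l..u} p" and p: "p l = 0" "p u = 0" "l \<le> u"
    and no_pos: "\<And>s t. l \<le> s \<Longrightarrow> s < t \<Longrightarrow> t \<le> u \<Longrightarrow> p s = 0 \<Longrightarrow> p t = 0 \<Longrightarrow> \<exists>x\<in>{s<..<t}. p x \<le> 0"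
    and no_neg: "\<And>s t. l < s \<Longrightarrow> s < t \<Longrightarrow> t \<le> u \<Longrightarrow> p s = 0 \<Longrightarrow> p t = 0
                   \<Longrightarrow> (\<And>x. l \<le> x \<Longrightarrow> x \<le> u \<Longrightarrow> p x \<le> 0) \<Longrightarrow> \<exists>x\<in>{s<..<t}. p x \<ge> 0"
  obtains m where "l \<le> m" "m \<le> u" "const_sign p l m" "const_sign p m u"
proof -
  have comp: "\<exists>s t. y \<le> s \<and> s < x \<and> x < t \<and> t \<le> u \<and> p s = 0 \<and> p t = 0 \<and> const_sign p s t"
    if yx: "l \<le> y" "y < x" "x < u" "p y = 0" "p x \<noteq> 0" for x y
  proof -
    have "continuous_on {y..u} p" using yx by (intro continuous_on_subset [OF cont]) auto
    then obtain s t where st: "y \<le> s" "s < x" "x < t" "t \<le> u" "p s = 0" "p t = 0"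
      "\<And>z. s < z \<Longrightarrow> z < t \<Longrightarrow> p z \<noteq> 0"
      by (rule nonzero_component [OF _ yx(4) p(2) yx(2,3,5)]) blast
    have "const_sign p s t"
      using st yx(1) by (intro const_sign_nonzero continuous_on_subset [OF cont]) auto
    with st show ?thesis by blast
  qed
  have le: "p x \<le> 0" if lxu: "l \<le> x" "x \<le> u" for x
  proof (rule ccontr)
    assume "\<not> p x \<le> 0"
    hence x: "p x > 0" by simp
    hence "x \<noteq> l" "x \<noteq> u" using p by auto
    hence "l < x" "x < u" using lxu by auto
    then obtain s t where st: "l \<le> s" "s < x" "x < t" "t \<le> u" "p s = 0" "p t = 0" "const_sign p s t"
      using comp [of l x] p(1) x by auto
    have "x \<in> {s<..<t}" using st by simp
    hence "\<forall>z\<in>{s<..<t}. p z > 0"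
      using st(7) x unfolding const_sign_def by (metis less_irrefl less_asym)
    thus False using no_pos [of s t] st by (metis less_trans not_le)
  qed
  \<comment> \<open>A zero at y > l would be followed, before x, by the start of a negative arc that
    \<open>no_neg\<close> forbids.\<close>
  have down: "p y < 0" if yx: "l < y" "y < x" "x < u" "p x < 0" for x y
  proof (rule ccontr)
    assume "\<not> p y < 0"
    hence "p y = 0" using le [of y] yx by simp
    then obtain s t where st: "y \<le> s" "s < x" "x < t" "t \<le> u" "p s = 0" "p t = 0" "const_sign p s t"
      using comp [of y x] yx by auto
    have "x \<in> {s<..<t}" using st by simp
    hence "\<forall>z\<in>{s<..<t}. p z < 0"
      using st(7) yx(4) unfolding const_sign_def by (metis less_irrefl less_asym)
    moreover have "\<exists>z\<in>{s<..<t}. p z \<ge> 0"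
      by (rule no_neg) (use st yx le in simp_all)
    ultimately show False by (metis not_le)
  qed
  define N where "N = {x \<in> {l<..<u}. p x < 0}"
  show ?thesis
  proof (cases "N = {}")
    case True
    hence "p x = 0" if "x \<in> {l<..<u}" for x
      using le [of x] that True by (metis (mono_tags, lifting) N_def empty_iff greaterThanLessThan_iff less_imp_le mem_Collect_eq order_less_le)
    hence "const_sign p l u" by (simp add: const_sign_def)
    moreover have "const_sign p u u" by (simp add: const_sign_def)
    ultimately show ?thesis using that [of u] p(3) by simp
  next
    case False
    define m where "m = Sup N"
    have bdd: "bdd_above N" by (rule bdd_aboveI [of _ u]) (auto simp: N_def)
    have m: "x \<le> m" if "x \<in> N" for x unfolding m_def using that bdd by (rule cSup_upper)
    have mu: "m \<le> u" unfolding m_def using False by (intro cSup_least) (auto simp: N_def)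
    obtain x0 where "x0 \<in> N" using False by blast
    hence lm: "l \<le> m" using m [of x0] by (simp add: N_def)
    have "p x < 0" if x: "x \<in> {l<..<m}" for x
    proof -
      obtain y where "y \<in> N" "x < y"
        using x less_cSup_iff [OF False bdd, of x] by (auto simp: m_def)
      thus ?thesis using down [of x y] x by (auto simp: N_def)
    qed
    moreover have "p x = 0" if x: "x \<in> {m<..<u}" for x
    proof (rule ccontr)
      assume "p x \<noteq> 0"
      hence "x \<in> N" using x lm le [of x] by (simp add: N_def order_less_le)
      thus False using m x by force
    qed
    ultimately show ?thesis
      using that [of m] lm mu by (simp add: const_sign_def)
  qed
qed

section \<open>Multipliers and the minimum condition\<close>

lemma mono_join:
  fixes h :: "real \<Rightarrow> real"
  assumes "\<And>x y. a \<le> x \<Longrightarrow> x \<le> y \<Longrightarrow> y \<le> s \<Longrightarrow> h x \<le> h y"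
    and "\<And>x y. s \<le> x \<Longrightarrow> x \<le> y \<Longrightarrow> y \<le> b \<Longrightarrow> h x \<le> h y"
    and "a \<le> x" "x \<le> y" "y \<le> b"
  shows "h x \<le> h y"
proof -
  consider "y \<le> s" | "s \<le> x" | "x \<le> s" "s \<le> y" by linarith
  thus ?thesis
  proof cases
    case 3
    have "h x \<le> h s" "h s \<le> h y" using assms 3 by simp_all
    thus ?thesis by simp
  qed (use assms in simp_all)
qed

section \<open>A multiplier for the area constraint\<close>

context drawdown
begin

text \<open>Minus the derivative of the terminal cost in d b, hence minus the costate at b.\<close>

definition terminal_weight where
  "terminal_weight b d = d2\<nu> b (b - d b) / \<nu> b (b - d b)"

text \<open>Minus the directional derivative of the cost at d towards e: positive values mean
  first-order improvement.\<close>

definition variation where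
  "variation b d e = integral {a..b} (\<lambda>t. d2\<nu> t (t - d t) * (e t - d t)) + terminal_weight b d * (e b - d b)"

lemma terminal_weight_pos:
  assumes "d0 > 0" "adm b d"
  shows "terminal_weight b d > 0"
  using adm_bounds [OF assms(2), of b] admissible_le [OF assms(2)] assms(1)
  unfolding terminal_weight_def by (intro divide_pos_pos d2_nu_pos nu_pos) auto

lemma integrable_variation:
  assumes "d0 > 0" "adm b d" "adm b e"
  shows "(\<lambda>t. d2\<nu> t (t - d t) * (e t - d t)) integrable_on {a..b}"
    and "(\<lambda>t. e t - d t) integrable_on {a..b}"
  by (intro integrable_continuous_real continuous_on_mult continuous_on_diff
        admissible_continuous [OF assms(2)] admissible_continuous [OF assms(3)]
        continuous_on_path(2) [OF assms(1,2)])+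

lemma admissible_convex_integral:
  assumes "adm b d" "adm b e"
  shows "integral {a..b} (\<lambda>t. d t + w * (e t - d t)) = integral {a..b} d + w * (integral {a..b} e - integral {a..b} d)"
proof -
  have "d integrable_on {a..b}" "e integrable_on {a..b}"
    using assms by (auto intro!: integrable_continuous_real admissible_continuous)
  hence "((\<lambda>t. d t + w * (e t - d t)) has_integral integral {a..b} d + w * (integral {a..b} e - integral {a..b} d)) {a..b}"
    by (intro has_integral_add has_integral_mult_right has_integral_diff integrable_integral)
  thus ?thesis by (rule integral_unique)
qed

text \<open>The pairs (change of area, variation) form a convex set in the plane. By
  \<open>first_variation\<close> it misses the pairs with positive variation that respect the area
  bound. A separating line that puts nonzero weight on the variation gives r as a quotient of its
  weights.\<close>

lemma multiplier:
  assumes ab: "a < b" and d0: "d0 > 0" and d: "adm b d" and K: "integral {a..b} d \<le> K"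
    and nc: "d b > d0"
    and opt: "\<And>e. adm b e \<Longrightarrow> integral {a..b} e \<le> K \<Longrightarrow> J b d \<le> J b e"
  obtains r where "r \<ge> 0" "\<And>e. adm b e \<Longrightarrow> variation b d e \<le> r * integral {a..b} (\<lambda>t. e t - d t)"
proof -
  define I where "I e = integral {a..b} (\<lambda>t. e t - d t)" for e
  have I: "I e = integral {a..b} e - integral {a..b} d" if "adm b e" for e
    unfolding I_def using d that
    by (intro Henstock_Kurzweil_Integration.integral_diff integrable_continuous_real admissible_continuous)
  define S where "S = (\<lambda>e. (I e, variation b d e)) ` {e. adm b e}"
  define T where "T = {..K - integral {a..b} d} \<times> {0::real<..}"
  have "convex S"
    unfolding convex_alt
  proof (intro ballI allI impI)
    fix x y w assume "x \<in> S" "y \<in> S" and w: "0 \<le> (w::real) \<and> w \<le> 1"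
    then obtain e f where e: "adm b e" "x = (I e, variation b d e)" and f: "adm b f" "y = (I f, variation b d f)"
      by (auto simp: S_def)
    define g where "g t = e t + w * (f t - e t)" for t
    have g: "adm b g" unfolding g_def using admissible_convex [OF e(1) f(1)] w by simp
    have "I g = (1 - w) * I e + w * I f"
      unfolding I [OF g] I [OF e(1)] I [OF f(1)]
      unfolding g_def [abs_def] admissible_convex_integral [OF e(1) f(1)]
      by (simp add: algebra_simps)
    moreover have "variation b d g = (1 - w) * variation b d e + w * variation b d f"
    proof -
      have "((\<lambda>t. (1 - w) * (d2\<nu> t (t - d t) * (e t - d t)) + w * (d2\<nu> t (t - d t) * (f t - d t)))
        has_integral (1 - w) * integral {a..b} (\<lambda>t. d2\<nu> t (t - d t) * (e t - d t))
          + w * integral {a..b} (\<lambda>t. d2\<nu> t (t - d t) * (f t - d t))) {a..b}"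
        using integrable_variation(1) [OF d0 d] e f
        by (intro has_integral_add has_integral_mult_right integrable_integral) auto
      also have "(\<lambda>t. (1 - w) * (d2\<nu> t (t - d t) * (e t - d t)) + w * (d2\<nu> t (t - d t) * (f t - d t)))
          = (\<lambda>t. d2\<nu> t (t - d t) * (g t - d t))"
        by (simp add: g_def fun_eq_iff algebra_simps)
      finally show ?thesis
        unfolding variation_def by (simp add: integral_unique) (simp add: g_def algebra_simps)
    qed
    ultimately have "(1 - w) *\<^sub>R x + w *\<^sub>R y = (I g, variation b d g)"
      by (simp add: e f)
    thus "(1 - w) *\<^sub>R x + w *\<^sub>R y \<in> S" using g by (auto simp: S_def)
  qed
  moreover have "convex T" unfolding T_def by (intro convex_Times) auto
  moreover have S0: "(0, 0) \<in> S"
    using d by (auto simp: S_def I_def variation_def intro!: image_eqI [of _ _ d])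
  moreover have "T \<noteq> {}" by (auto simp: T_def)
  moreover have "S \<inter> T = {}"
  proof -
    have "variation b d e \<le> 0" if e: "adm b e" and "I e \<le> K - integral {a..b} d" for e
      unfolding variation_def terminal_weight_def
    proof (rule first_variation [OF d0 d e])
      fix w :: real assume w: "0 \<le> w" "w \<le> 1"
      have "w * I e \<le> K - integral {a..b} d"
      proof (cases "I e \<le> 0")
        case True
        thus ?thesis using w K by (smt (verit) mult_nonneg_nonpos)
      next
        case False
        hence "w * I e \<le> I e" using w by (simp add: mult_left_le_one_le)
        thus ?thesis using that(2) by simp
      qed
      thus "J b d \<le> J b (\<lambda>t. d t + w * (e t - d t))"
        using admissible_convex [OF d e w] admissible_convex_integral [OF d e, of w] I [OF e]
        by (intro opt) auto
    qed
    thus ?thesis by (force simp: S_def T_def)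
  qed
  moreover have "S \<noteq> {}" using S0 by auto
  ultimately obtain v c where vc: "v \<noteq> 0" "\<And>x. x \<in> S \<Longrightarrow> v \<bullet> x \<le> c" "\<And>x. x \<in> T \<Longrightarrow> c \<le> v \<bullet> x"
    using separating_hyperplane_sets [of S T] by metis
  obtain v1 v2 where v: "v = (v1, v2)" by (cases v)
  have c0: "c \<ge> 0" using vc(2) [OF S0] by (simp add: v)
  have T: "c \<le> v1 * x + v2 * y" if "x \<le> 0" "y > 0" for x y
    using vc(3) [of "(x, y)"] that K by (simp add: T_def v)
  have v1: "v1 \<le> 0"
  proof (rule ccontr)
    assume "\<not> v1 \<le> 0"
    \<comment> \<open>A point of \<open>T\<close> at height 1, so far to the left that the
      functional is negative there although \<open>T\<close> lies above
      \<open>c \<ge> 0\<close>.\<close>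
    hence "v1 * (- (\<bar>v2\<bar> + 1) / v1) + v2 * 1 < 0" by simp
    moreover have "c \<le> v1 * (- (\<bar>v2\<bar> + 1) / v1) + v2 * 1"
      using \<open>\<not> v1 \<le> 0\<close> by (intro T) (auto simp: divide_nonpos_nonneg)
    ultimately show False using c0 by simp
  qed
  have v2: "v2 \<ge> 0" using T [of 0 1] c0 by simp
  have c: "c = 0"
  proof (rule ccontr)
    assume "c \<noteq> 0"
    hence "c > 0" using c0 by simp
    have "c \<le> v2 * (c / (2 * (v2 + 1)))"
      using T [of 0 "c / (2 * (v2 + 1))"] v2 \<open>c > 0\<close> by simp
    also have "\<dots> < c" using v2 \<open>c > 0\<close> by (simp add: field_simps add_nonneg_pos)
    finally show False by simp
  qed
  have sep: "v1 * I e + v2 * variation b d e \<le> 0" if "adm b e" for e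
    using vc(2) [of "(I e, variation b d e)"] that by (auto simp: S_def v c)
  \<comment> \<open>A Slater condition: the constant profile has strictly smaller area than d
    because d b > d0, so a vertical line cannot separate.\<close>
  have "v2 \<noteq> 0"
  proof
    assume "v2 = 0"
    hence "v1 < 0" using vc(1) v1 by (auto simp: v zero_prod_def)
    have const: "adm b (\<lambda>t. d0)"
      using admissible_affine [of a b 0 \<xi> d0] ab xi by simp
    have "v1 * I (\<lambda>t. d0) \<le> 0"
      using sep [OF const] \<open>v2 = 0\<close> by simp
    hence "I (\<lambda>t. d0) \<ge> 0" using \<open>v1 < 0\<close> by (simp add: mult_le_0_iff)
    hence le: "integral {a..b} (\<lambda>t. d t - d0) \<le> 0"
      using integral_neg [of "{a..b}" "\<lambda>t. d t - d0"] by (simp add: I_def)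
    have cont: "continuous_on {a..b} (\<lambda>t. d t - d0)"
      using d by (intro continuous_intros admissible_continuous)
    have nn: "d t - d0 \<ge> 0" if "t \<in> {a..b}" for t
      using adm_bounds(1) [OF d] that by auto
    have "integral {a..b} (\<lambda>t. d t - d0) \<ge> 0"
      using nn cont by (intro Henstock_Kurzweil_Integration.integral_nonneg integrable_continuous_real) auto
    hence "integral {a..b} (\<lambda>t. d t - d0) = 0" using le by simp
    hence "\<forall>t\<in>{a..b}. d t - d0 = 0"
      using integral_eq_0_iff [OF cont ab] nn by auto
    thus False using nc ab by auto
  qed
  hence v2': "v2 > 0" using v2 by simp
  have "variation b d e \<le> (- v1 / v2) * integral {a..b} (\<lambda>t. e t - d t)" if "adm b e" for e
    using sep [OF that] v2' by (simp add: I_def field_simps)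
  moreover have "- v1 / v2 \<ge> 0" using v1 v2' by (simp add: divide_nonpos_pos)
  ultimately show ?thesis using that by blast
qed

end

section \<open>Minimum condition for the costate\<close>

locale extremal = drawdown +
  fixes b r :: real and d :: "real \<Rightarrow> real"
  assumes ab: "a < b" and d0_pos: "d0 > 0" and adm_d: "adm b d" and r_nonneg: "r \<ge> 0"
    and multiplier: "\<And>e. adm b e \<Longrightarrow> variation b d e \<le> r * integral {a..b} (\<lambda>t. e t - d t)"
begin

text \<open>The derivative of the costate; \<open>f t = 0\<close> is the structure equation with
  costate r.\<close>

definition f where "f t = d2\<nu> t (t - d t) - r"

abbreviation p where "p \<equiv> costate \<alpha> \<beta> \<epsilon> q r b d"

lemma p_eq: "p t = - terminal_weight b d - integral {t..b} f"
  by (simp add: costate_def terminal_weight_def f_def [abs_def])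

lemma path: "t \<in> {a..b} \<Longrightarrow> 0 < d t \<and> shift (t - d t) > 0 \<and> t - d t < t"
  using adm_bounds [OF adm_d, of t] d0_pos by auto

lemma f_continuous: "continuous_on {a..b} f"
  unfolding f_def
  by (intro continuous_on_diff continuous_on_const continuous_on_path(2) [OF d0_pos adm_d])

lemma f_integrable: "a \<le> s \<Longrightarrow> t \<le> b \<Longrightarrow> f integrable_on {s..t}"
  by (intro integrable_continuous_real continuous_on_subset [OF f_continuous]) auto

lemma p_end: "p b < 0"
  using terminal_weight_pos [OF d0_pos adm_d] by (simp add: p_eq)

lemma p_derivative:
  assumes "t \<in> {a..b}"
  shows "(p has_real_derivative f t) (at t within {a..b})"
proof -
  have "((\<lambda>t. - terminal_weight b d - integral {t..b} f) has_real_derivative 0 - - f t) (at t within {a..b})"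
    by (rule DERIV_diff [OF DERIV_const integral_has_real_derivative' [OF f_continuous assms]])
  thus ?thesis by (simp add: p_eq [abs_def])
qed

lemma p_continuous: "continuous_on {a..b} p"
  by (rule DERIV_continuous_on) (rule p_derivative)

text \<open>The second mean value theorem replaces the monotone h by its end values 0 and h t. What
  survives, the integral of f over [z, b] together with the terminal weight, is - p z. So the sign
  of the variation is read off at a single point of [s, t].\<close>

lemma shifted_variation:
  assumes st: "a \<le> s" "s \<le> t" "t \<le> b" and mono: "\<And>x y. a \<le> x \<Longrightarrow> x \<le> y \<Longrightarrow> y \<le> b \<Longrightarrow> h x \<le> h y"
    and left: "\<And>x. a \<le> x \<Longrightarrow> x \<le> s \<Longrightarrow> h x = 0" and right: "\<And>x. t \<le> x \<Longrightarrow> x \<le> b \<Longrightarrow> h x = h t"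
    and int: "(\<lambda>x. h x * f x) integrable_on {a..b}"
  obtains z where "s \<le> z" "z \<le> t" "integral {a..b} (\<lambda>x. h x * f x) + terminal_weight b d * h b = - (h t * p z)"
proof -
  have sub: "(\<lambda>x. h x * f x) integrable_on {x..y}" if "a \<le> x" "y \<le> b" for x y
    using that by (intro integrable_on_subinterval [OF int]) auto
  obtain z where z: "z \<in> {s..t}"
    "integral {s..t} (\<lambda>x. h x * f x) = h s * integral {s..z} f + h t * integral {z..t} f"
  proof (rule second_mean_value_theorem [OF f_integrable [OF st(1,3)] st(2), of h])
    show "h x \<le> h y" if "s \<le> x" "x \<le> y" "y \<le> t" for x y
      using that st by (intro mono) auto
  qed blast
  have "integral {t..b} (\<lambda>x. h x * f x) = integral {t..b} (\<lambda>x. h t * f x)"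
  proof (rule integral_cong)
    fix x assume "x \<in> {t..b}"
    hence "h x = h t" using right [of x] by simp
    thus "h x * f x = h t * f x" by simp
  qed
  hence tail: "integral {t..b} (\<lambda>x. h x * f x) = h t * integral {t..b} f" by simp
  have "integral {a..b} (\<lambda>x. h x * f x) = integral {a..s} (\<lambda>x. h x * f x) + integral {s..b} (\<lambda>x. h x * f x)"
    using st sub by (intro Henstock_Kurzweil_Integration.integral_combine [symmetric]) auto
  also have "integral {s..b} (\<lambda>x. h x * f x) = integral {s..t} (\<lambda>x. h x * f x) + integral {t..b} (\<lambda>x. h x * f x)"
    using st sub by (intro Henstock_Kurzweil_Integration.integral_combine [symmetric]) auto
  also have "integral {a..s} (\<lambda>x. h x * f x) = integral {a..s} (\<lambda>x. 0)"
    using left by (intro integral_cong) auto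
  also note tail
  also have "integral {a..s} (\<lambda>x. 0) + (integral {s..t} (\<lambda>x. h x * f x) + h t * integral {t..b} f)
      = h t * (integral {z..t} f + integral {t..b} f)"
    using z(2) left [of s] st by (simp add: algebra_simps)
  also have "integral {z..t} f + integral {t..b} f = integral {z..b} f"
    using z(1) st f_integrable by (intro Henstock_Kurzweil_Integration.integral_combine) auto
  finally have "integral {a..b} (\<lambda>x. h x * f x) = h t * integral {z..b} f" .
  moreover have "h b = h t" using right [of b] st by simp
  ultimately have "integral {a..b} (\<lambda>x. h x * f x) + terminal_weight b d * h b = - (h t * p z)"
    by (simp add: p_eq algebra_simps)
  thus ?thesis using that z by auto
qed

lemma variation_le:
  assumes e: "adm b e"
  shows "(\<lambda>x. (e x - d x) * f x) integrable_on {a..b}"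
    and "integral {a..b} (\<lambda>x. (e x - d x) * f x) + terminal_weight b d * (e b - d b) \<le> 0"
proof -
  have *: "((\<lambda>x. d2\<nu> x (x - d x) * (e x - d x) - r * (e x - d x)) has_integral
      integral {a..b} (\<lambda>t. d2\<nu> t (t - d t) * (e t - d t)) - r * integral {a..b} (\<lambda>t. e t - d t)) {a..b}"
    using integrable_variation [OF d0_pos adm_d e]
    by (intro has_integral_diff has_integral_mult_right integrable_integral)
  also have "(\<lambda>x. d2\<nu> x (x - d x) * (e x - d x) - r * (e x - d x)) = (\<lambda>x. (e x - d x) * f x)"
    by (simp add: f_def fun_eq_iff algebra_simps)
  finally have *: "((\<lambda>x. (e x - d x) * f x) has_integral
      integral {a..b} (\<lambda>t. d2\<nu> t (t - d t) * (e t - d t)) - r * integral {a..b} (\<lambda>t. e t - d t)) {a..b}" .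
  thus "(\<lambda>x. (e x - d x) * f x) integrable_on {a..b}" by (rule has_integral_integrable)
  show "integral {a..b} (\<lambda>x. (e x - d x) * f x) + terminal_weight b d * (e b - d b) \<le> 0"
    using integral_unique [OF *] multiplier [OF e] by (simp add: variation_def)
qed

text \<open>The competitor takes the largest slope on [s, t], so h = e - d is nondecreasing, and h t
  > 0 would make the variation positive at a point where p < 0. That point may be an end of [s, t],
  hence the closed interval in the premise.\<close>

lemma negative_costate_slope:
  assumes st: "a \<le> s" "s \<le> t" "t \<le> b" and neg: "\<And>x. s \<le> x \<Longrightarrow> x \<le> t \<Longrightarrow> p x < 0"
  shows "d t = d s + (1 - \<xi>) * (t - s)"
proof -
  obtain e where e: "adm b e" "\<And>x. a \<le> x \<Longrightarrow> x \<le> s \<Longrightarrow> e x = d x"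
    "\<And>x. s \<le> x \<Longrightarrow> x \<le> t \<Longrightarrow> e x = d s + (1 - \<xi>) * (x - s)"
    "\<And>x. t \<le> x \<Longrightarrow> x \<le> b \<Longrightarrow> e x - d x = e t - d t"
    using admissible_modify [OF adm_d st, of "1 - \<xi>"] xi by auto
  define h where "h x = e x - d x" for x
  have mid: "h x \<le> h y" if "s \<le> x" "x \<le> y" "y \<le> t" for x y
    using admissible_increment(2) [OF adm_d, of x y] that st e(3) [of x] e(3) [of y]
    by (simp add: h_def algebra_simps)
  have mono: "h x \<le> h y" if "a \<le> x" "x \<le> y" "y \<le> b" for x y
  proof (rule mono_join [of a t h b, OF mono_join [of a s h t] _ that])
    show "h x \<le> h y" if "a \<le> x" "x \<le> y" "y \<le> s" for x y using e(2) that by (simp add: h_def)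
    show "h x \<le> h y" if "s \<le> x" "x \<le> y" "y \<le> t" for x y using mid that by blast
    show "h x \<le> h y" if "t \<le> x" "x \<le> y" "y \<le> b" for x y
      using e(4) [of x] e(4) [of y] that by (simp add: h_def)
  qed
  have left: "h x = 0" if "a \<le> x" "x \<le> s" for x using e(2) that by (simp add: h_def)
  have right: "h x = h t" if "t \<le> x" "x \<le> b" for x using e(4) [OF that] by (simp add: h_def)
  obtain z where z: "s \<le> z" "z \<le> t" "integral {a..b} (\<lambda>x. h x * f x) + terminal_weight b d * h b = - (h t * p z)"
  proof (rule shifted_variation [where h = h, OF st mono left right])
    show "(\<lambda>x. h x * f x) integrable_on {a..b}"
      unfolding h_def by (rule variation_le(1) [OF e(1)])
  qed
  have "- (h t * p z) \<le> 0" using variation_le(2) [OF e(1)] z(3) by (simp add: h_def)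
  hence "h t \<le> 0" using neg [of z] z by (auto simp: zero_le_mult_iff)
  moreover have "h t \<ge> 0" using mid [of s t] left [of s] st by simp
  ultimately show ?thesis using e(3) [of t] st by (simp add: h_def)
qed

text \<open>Mirror image: the competitor rests on [s, t], and d - e is the nondecreasing
  function.\<close>

lemma positive_costate_slope:
  assumes st: "a \<le> s" "s \<le> t" "t \<le> b" and pos: "\<And>x. s \<le> x \<Longrightarrow> x \<le> t \<Longrightarrow> p x > 0"
  shows "d t = d s"
proof -
  obtain e where e: "adm b e" "\<And>x. a \<le> x \<Longrightarrow> x \<le> s \<Longrightarrow> e x = d x"
    "\<And>x. s \<le> x \<Longrightarrow> x \<le> t \<Longrightarrow> e x = d s"
    "\<And>x. t \<le> x \<Longrightarrow> x \<le> b \<Longrightarrow> e x - d x = e t - d t"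
    using admissible_modify [OF adm_d st, of 0] xi by auto
  define h where "h x = d x - e x" for x
  have mid: "h x \<le> h y" if "s \<le> x" "x \<le> y" "y \<le> t" for x y
    using admissible_increment(1) [OF adm_d, of x y] that st e(3) [of x] e(3) [of y]
    by (simp add: h_def)
  have e4: "d x - e x = d t - e t" if "t \<le> x" "x \<le> b" for x using e(4) [OF that] by simp
  have mono: "h x \<le> h y" if "a \<le> x" "x \<le> y" "y \<le> b" for x y
  proof (rule mono_join [of a t h b, OF mono_join [of a s h t] _ that])
    show "h x \<le> h y" if "a \<le> x" "x \<le> y" "y \<le> s" for x y using e(2) that by (simp add: h_def)
    show "h x \<le> h y" if "s \<le> x" "x \<le> y" "y \<le> t" for x y using mid that by blast
    show "h x \<le> h y" if "t \<le> x" "x \<le> y" "y \<le> b" for x y using e4 [of x] e4 [of y] that by (simp add: h_def)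
  qed
  have left: "h x = 0" if "a \<le> x" "x \<le> s" for x using e(2) that by (simp add: h_def)
  have right: "h x = h t" if "t \<le> x" "x \<le> b" for x using e4 [OF that] by (simp add: h_def)
  have hf: "h x * f x = - ((e x - d x) * f x)" for x by (simp add: h_def algebra_simps)
  obtain z where z: "s \<le> z" "z \<le> t" "integral {a..b} (\<lambda>x. h x * f x) + terminal_weight b d * h b = - (h t * p z)"
  proof (rule shifted_variation [where h = h, OF st mono left right])
    show "(\<lambda>x. h x * f x) integrable_on {a..b}"
      unfolding hf by (intro integrable_neg variation_le(1) e(1))
  qed
  have "integral {a..b} (\<lambda>x. h x * f x) = - integral {a..b} (\<lambda>x. (e x - d x) * f x)"
    unfolding hf by (rule integral_neg)
  moreover have "h b = - (e b - d b)" by (simp add: h_def)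
  ultimately have "integral {a..b} (\<lambda>x. h x * f x) + terminal_weight b d * h b
      = - (integral {a..b} (\<lambda>x. (e x - d x) * f x) + terminal_weight b d * (e b - d b))"
    by (simp only: mult_minus_right minus_add_distrib)
  hence "h t * p z \<le> 0" using variation_le(2) [OF e(1)] z(3) by simp
  hence "h t \<le> 0" using pos [of z] z by (auto simp: mult_le_0_iff)
  moreover have "h t \<ge> 0" using mid [of s t] left [of s] st by simp
  ultimately show ?thesis using e(3) [of t] st by (simp add: h_def)
qed

end

section \<open>Arcs of an extremal\<close>

context extremal
begin

lemma interior_derivative:
  assumes "a < x" "x < b"
  shows "(p has_real_derivative f x) (at x)"
  using p_derivative [of x] assms at_within_interior [of x "{a..b}"] by simp

lemma p_mean_value:
  assumes "a \<le> x" "x < y" "y \<le> b"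
  obtains z where "x < z" "z < y" "p y - p x = (y - x) * f z"
proof -
  have "(p has_real_derivative f t) (at t within {a..b})" if "a \<le> t" "t \<le> b" for t
    using p_derivative that by simp
  from mean_value_within [OF this assms] that show ?thesis by blast
qed

text \<open>Fermat's rule where the costate touches 0 from below; l < x < b makes the contact point
  interior.\<close>

lemma f_zero_at_maximum:
  assumes "a < x" "x < b" "a \<le> l" "l < x" "p x = 0" "\<And>y. l \<le> y \<Longrightarrow> y \<le> b \<Longrightarrow> p y \<le> 0"
  shows "f x = 0"
proof (rule DERIV_local_max [OF interior_derivative [OF assms(1,2)]])
  show "0 < min (x - l) (b - x)" using assms by simp
  show "\<forall>y. \<bar>x - y\<bar> < min (x - l) (b - x) \<longrightarrow> p y \<le> p x"
  proof (intro allI impI)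
    fix y assume "\<bar>x - y\<bar> < min (x - l) (b - x)"
    hence "l \<le> y" "y \<le> b" by auto
    thus "p y \<le> p x" using assms(5,6) by simp
  qed
qed

text \<open>The slope statement applies to compact subintervals of the open arc; d x - (1 - \<xi>) *
  x, constant inside, extends to the ends by continuity.\<close>

lemma negative_arc:
  assumes st: "a \<le> s" "s < t" "t \<le> b" and neg: "\<And>x. s < x \<Longrightarrow> x < t \<Longrightarrow> p x < 0"
  shows "max_slope_piece \<xi> d s t"
proof -
  define \<phi> where "\<phi> x = d x - (1 - \<xi>) * x" for x
  define m where "m = (s + t) / 2"
  have le: "\<phi> y = \<phi> x" if "s < x" "x \<le> y" "y < t" for x y
    using negative_costate_slope [of x y] neg that st by (simp add: \<phi>_def algebra_simps)
  have m: "s < m" "m < t" using st by (auto simp: m_def)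
  have const: "\<phi> x = \<phi> m" if x: "x \<in> {s<..<t}" for x
  proof (cases "x \<le> m")
    case True
    show ?thesis by (rule le [symmetric]) (use x True m in auto)
  next
    case False
    show ?thesis by (rule le) (use x False m in auto)
  qed
  have "continuous_on {s..t} \<phi>"
    unfolding \<phi>_def using st
    by (intro continuous_on_diff continuous_on_mult continuous_on_const continuous_on_id
          continuous_on_subset [OF admissible_continuous [OF adm_d]]) auto
  hence cl: "continuous_on (closure {s<..<t}) \<phi>" using st by (simp add: closure_greaterThanLessThan)
  hence const': "\<phi> x = \<phi> m" if "x \<in> {s..t}" for x
    using continuous_constant_on_closure [OF cl const] that st
    by (simp add: closure_greaterThanLessThan)
  have "d x = d s + (1 - \<xi>) * (x - s)" if "x \<in> {s..t}" for x
    using const' [OF that] const' [of s] st by (simp add: \<phi>_def algebra_simps)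
  thus ?thesis unfolding max_slope_piece_def by blast
qed

lemma positive_arc:
  assumes st: "a \<le> s" "s < t" "t \<le> b" and pos: "\<And>x. s < x \<Longrightarrow> x < t \<Longrightarrow> p x > 0"
  shows "rest_piece \<alpha> \<beta> \<epsilon> q r b d s t"
proof -
  define m where "m = (s + t) / 2"
  have le: "d y = d x" if "s < x" "x \<le> y" "y < t" for x y
    using positive_costate_slope [of x y] pos that st by simp
  have m: "s < m" "m < t" using st by (auto simp: m_def)
  have const: "d x = d m" if x: "x \<in> {s<..<t}" for x
  proof (cases "x \<le> m")
    case True
    show ?thesis by (rule le [symmetric]) (use x True m in auto)
  next
    case False
    show ?thesis by (rule le) (use x False m in auto)
  qed
  have "continuous_on {s..t} d"
    using st by (intro continuous_on_subset [OF admissible_continuous [OF adm_d]]) auto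
  hence cl: "continuous_on (closure {s<..<t}) d" using st by (simp add: closure_greaterThanLessThan)
  hence const': "d x = d m" if "x \<in> {s..t}" for x
    using continuous_constant_on_closure [OF cl const] that st
    by (simp add: closure_greaterThanLessThan)
  have "d x = d s" if "x \<in> {s..t}" for x
    using const' [OF that] const' [of s] st by (metis atLeastAtMost_iff less_imp_le order_refl)
  moreover have "\<forall>x\<in>{s<..<t}. p x > 0" using pos by simp
  ultimately show ?thesis unfolding rest_piece_def by blast
qed

text \<open>A vanishing costate has derivative f = 0 inside the arc and, by continuity of f, at its
  ends; the witness for \<Delta> is the log-ratio of d.\<close>

lemma zero_arc:
  assumes st: "a \<le> s" "s < t" "t \<le> b" and zero: "\<And>x. s < x \<Longrightarrow> x < t \<Longrightarrow> p x = 0"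
  shows "structure_piece \<alpha> \<beta> \<epsilon> q r d s t"
proof -
  have f0: "f x = 0" if x: "x \<in> {s<..<t}" for x
  proof -
    have "((\<lambda>x. 0) has_real_derivative f x) (at x)"
      by (rule has_field_derivative_transform_within_open [of p "f x" x "{s<..<t}"])
         (use interior_derivative [of x] x st zero in auto)
    thus ?thesis using DERIV_unique [of "\<lambda>x. 0" "f x" x 0] by simp
  qed
  have "continuous_on {s..t} f"
    using st by (intro continuous_on_subset [OF f_continuous]) auto
  hence cl: "continuous_on (closure {s<..<t}) f" using st by (simp add: closure_greaterThanLessThan)
  hence f0': "f x = 0" if "x \<in> {s..t}" for x
    using continuous_constant_on_closure [OF cl f0] that st
    by (simp add: closure_greaterThanLessThan)
  have "structure_eq \<alpha> \<beta> \<epsilon> q r x (log_ratio \<alpha> \<beta> x (d x)) \<and>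
        d x = (x + \<beta> / \<alpha>) * (1 - exp (- log_ratio \<alpha> \<beta> x (d x)))" if "x \<in> {s..t}" for x
  proof -
    have "x \<in> {a..b}" using that st by auto
    note path = path [OF this]
    have "d2\<nu> x (x - d x) = r" using f0' [OF that] by (simp add: f_def)
    thus ?thesis
      using structure_eq_iff [of "d x" x r] log_ratio_profile(2) [of "d x" x] path r_nonneg by blast
  qed
  thus ?thesis unfolding structure_piece_def by (intro exI [of _ "\<lambda>x. log_ratio \<alpha> \<beta> x (d x)"]) blast
qed

lemma f_le_iff:
  assumes "x \<in> {a..b}" "y \<in> {a..b}"
  shows "f x \<le> f y \<longleftrightarrow> gap k (shift y) (shift (y - d y)) \<le> gap k (shift x) (shift (x - d x))"
  using d2_nu_le_iff [of "x - d x" x "y - d y" y] path [OF assms(1)] path [OF assms(2)]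
  by (simp add: f_def)

text \<open>X advances by y - x and Y by some \<sigma> between 0 and y - x, so
  \<open>gap_increasing\<close> applies. The costate is therefore concave.\<close>

lemma f_decreasing:
  assumes k: "k \<le> 1" and xy: "a \<le> x" "x \<le> y" "y \<le> b"
  shows "f y \<le> f x"
proof -
  define \<sigma> where "\<sigma> = (y - x) - (d y - d x)"
  have "d x \<le> d y" "d y \<le> d x + (1 - \<xi>) * (y - x)"
    using admissible_increment [OF adm_d, of x y] xy by auto
  moreover have "(1 - \<xi>) * (y - x) \<le> 1 * (y - x)"
    using xi xy by (intro mult_right_mono) auto
  ultimately have "0 \<le> \<sigma>" "\<sigma> \<le> y - x" by (simp_all add: \<sigma>_def)
  hence "gap k (shift x) (shift (x - d x)) \<le> gap k (shift x + (y - x)) (shift (x - d x) + \<sigma>)"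
    using path [of x] xy by (intro gap_increasing [OF k_pos k]) auto
  also have "shift x + (y - x) = shift y" by simp
  also have "shift (x - d x) + \<sigma> = shift (y - d y)" by (simp add: \<sigma>_def)
  finally show ?thesis using f_le_iff [of y x] xy by simp
qed

text \<open>On a positive arc d is constant, so the gap does not grow and f does not fall. The
  costate would be convex there, and its zero end values contradict positivity.\<close>

lemma no_interior_rest_arc:
  assumes k: "k \<ge> 1" and st: "a \<le> s" "s < t" "t \<le> b" and p: "p s = 0" "p t = 0"
  shows "\<exists>x\<in>{s<..<t}. p x \<le> 0"
proof (rule ccontr)
  assume "\<not> ?thesis"
  hence pos: "p x > 0" if "s < x" "x < t" for x using that by (auto simp: not_le)
  have "rest_piece \<alpha> \<beta> \<epsilon> q r b d s t" using positive_arc [OF st pos] by blast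
  hence dc: "d x = d s" if "s \<le> x" "x \<le> t" for x
    using that unfolding rest_piece_def by (meson atLeastAtMost_iff)
  define m where "m = (s + t) / 2"
  have m: "s < m" "m < t" using st by (auto simp: m_def)
  have mb: "a \<le> s" "m \<le> b" "a \<le> m" using m st by auto
  obtain z1 where z1: "s < z1" "z1 < m" "p m - p s = (m - s) * f z1"
    by (rule p_mean_value [OF mb(1) m(1) mb(2)])
  obtain z2 where z2: "m < z2" "z2 < t" "p t - p m = (t - m) * f z2"
    by (rule p_mean_value [OF mb(3) m(2) st(3)])
  have "(m - s) * f z1 > 0" "(t - m) * f z2 < 0" using z1(3) z2(3) p pos [OF m] by linarith+
  hence "f z1 > 0" "f z2 < 0" using m by (simp_all add: zero_less_mult_iff mult_less_0_iff)
  moreover have "f z1 \<le> f z2"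
  proof -
    have "gap k (shift z1 + (z2 - z1)) (shift (z1 - d s) + (z2 - z1)) \<le> gap k (shift z1) (shift (z1 - d s))"
      using path [of z1] dc [of z1] z1(1,2) z2(1,2) m st by (intro gap_parallel_decreasing k) auto
    moreover have "shift z1 + (z2 - z1) = shift z2" "shift (z1 - d s) + (z2 - z1) = shift (z2 - d s)"
      by simp_all
    ultimately show ?thesis
      using f_le_iff [of z1 z2] dc [of z1] dc [of z2] z1(1,2) z2(1,2) m st by simp
  qed
  ultimately show False by simp
qed

text \<open>On a negative arc the path (X, Y) is a straight line, so the gap is convex along it and
  bounded by its common end value. Thus f >= 0 on the arc, and the costate cannot descend from
  0.\<close>

lemma no_interior_max_arc:
  assumes k: "k \<ge> 1" and st: "a < s" "s < t" "t \<le> b" and p: "p s = 0" "p t = 0"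
    and f: "f s = 0" "f t = 0"
  shows "\<exists>x\<in>{s<..<t}. p x \<ge> 0"
proof (rule ccontr)
  assume "\<not> ?thesis"
  hence neg: "p x < 0" if "s < x" "x < t" for x using that by (auto simp: not_le)
  have sl: "d x = d s + (1 - \<xi>) * (x - s)" if "s \<le> x" "x \<le> t" for x
  proof -
    have "max_slope_piece \<xi> d s t" using neg st by (intro negative_arc) auto
    thus ?thesis using that unfolding max_slope_piece_def by (meson atLeastAtMost_iff)
  qed
  define G where "G x = gap k (shift x) (shift (x - d x))" for x
  have "f s \<le> f t" "f t \<le> f s" using f by simp_all
  hence eq: "G s = G t" using f_le_iff [of s t] f_le_iff [of t s] st by (simp add: G_def)
  have fpos: "f x \<ge> 0" if x: "s \<le> x" "x \<le> t" for x
  proof -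
    define w where "w = (x - s) / (t - s)"
    have w: "0 \<le> w" "w \<le> 1" using x st by (auto simp: w_def)
    have xw: "x = s + w * (t - s)" using st by (simp add: w_def)
    have "G x \<le> (1 - w) * G s + w * G t"
    proof -
      have le: "gap k ((1 - w) * shift s + w * shift t) ((1 - w) * shift (s - d s) + w * shift (t - d t))
          \<le> (1 - w) * G s + w * G t"
        unfolding G_def using path [of s] path [of t] st w by (intro gap_convex k) auto
      have aff: "(1 - w) * (u + c) + w * (v + c) = u + w * (v - u) + c" for u v c :: real
        by (simp add: algebra_simps)
      have "(1 - w) * shift s + w * shift t = shift x"
        unfolding aff using xw by simp
      moreover have "(1 - w) * shift (s - d s) + w * shift (t - d t) = shift (x - d x)"
      proof -
        have "w * (t - s) = x - s" using xw by simp
        moreover have "d x = d s + (1 - \<xi>) * (x - s)" "d t = d s + (1 - \<xi>) * (t - s)"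
          using sl [of x] sl [of t] x st by auto
        ultimately have "w * ((t - d t) - (s - d s)) = (x - d x) - (s - d s)"
          by algebra
        thus ?thesis unfolding aff by simp
      qed
      ultimately show ?thesis using le by (simp only: G_def)
    qed
    also have "\<dots> = G s" unfolding eq by (simp add: algebra_simps)
    finally have "f s \<le> f x" using f_le_iff [of s x] x st by (simp add: G_def)
    thus ?thesis using f by simp
  qed
  define m where "m = (s + t) / 2"
  have m: "s < m" "m < t" using st by (auto simp: m_def)
  have mb: "a \<le> s" "m \<le> b" using m st by auto
  obtain z where z: "s < z" "z < m" "p m - p s = (m - s) * f z"
    by (rule p_mean_value [OF mb(1) m(1) mb(2)])
  have "(m - s) * f z \<ge> 0" using fpos [of z] z(1,2) m by (intro mult_nonneg_nonneg) auto
  thus False using z(3) p neg [OF m] by linarith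
qed

lemma costate_sign_pieces: "piecewise (const_sign p) a b"
proof (cases "\<exists>z\<in>{a..b}. p z = 0")
  case False
  hence "const_sign p a b"
    by (intro const_sign_nonzero continuous_on_subset [OF p_continuous]) auto
  thus ?thesis using ab by (intro piecewise_single) auto
next
  case True
  then obtain z where "z \<in> {a..b}" "p z = 0" by blast
  then obtain s t where st: "a \<le> s" "s \<le> t" "t \<le> b" "p s = 0" "p t = 0"
    and left: "\<And>x. a \<le> x \<Longrightarrow> x < s \<Longrightarrow> p x \<noteq> 0" and right: "\<And>x. t < x \<Longrightarrow> x \<le> b \<Longrightarrow> p x \<noteq> 0"
    by (rule zero_set_bounds [OF p_continuous]) blast
  have tb: "t < b" using p_end st by (cases "t = b") auto
  have "const_sign p a s"
    using st left by (intro const_sign_nonzero continuous_on_subset [OF p_continuous]) auto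
  hence 1: "piecewise (const_sign p) a s" using st by (intro piecewise_single) auto
  have 3: "const_sign p t b"
    using st right by (intro const_sign_nonzero continuous_on_subset [OF p_continuous]) auto
  have right_neg: "p y < 0" if "t < y" "y \<le> b" for y
    by (rule same_sign [of "{t<..b}" p b y])
       (use right that tb p_end st in \<open>auto intro!: continuous_on_subset [OF p_continuous] is_interval_oc\<close>)
  obtain m where m: "s \<le> m" "m \<le> t" "const_sign p s m" "const_sign p m t"
  proof (cases "k \<le> 1")
    case True
    have "const_sign p s t"
    proof (rule const_sign_concave)
      show "(p has_real_derivative f x) (at x within {s..t})" if "s \<le> x" "x \<le> t" for x
        using that st by (intro DERIV_subset [OF p_derivative]) auto
      show "f y \<le> f x" if "s \<le> x" "x \<le> y" "y \<le> t" for x y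
        using that st by (intro f_decreasing [OF True]) auto
    qed (use st in auto)
    moreover have "const_sign p t t" by (simp add: const_sign_def)
    ultimately show ?thesis using that [of t] st by blast
  next
    case False
    hence k: "k \<ge> 1" by simp
    show ?thesis
    proof (rule const_sign_split [of s t p])
      show "continuous_on {s..t} p" using st by (intro continuous_on_subset [OF p_continuous]) auto
      show "\<exists>x\<in>{x<..<y}. p x \<le> 0" if "s \<le> x" "x < y" "y \<le> t" "p x = 0" "p y = 0" for x y
        using that st by (intro no_interior_rest_arc k) auto
      show "\<exists>x\<in>{x<..<y}. p x \<ge> 0" if xy: "s < x" "x < y" "y \<le> t" "p x = 0" "p y = 0"
        and le: "\<And>x. s \<le> x \<Longrightarrow> x \<le> t \<Longrightarrow> p x \<le> 0" for x y
      proof -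
        \<comment> \<open>Extending the bound beyond t makes the last zero t an interior contact as
          well, so f vanishes there too.\<close>
        have le': "p z \<le> 0" if "s \<le> z" "z \<le> b" for z
          using le [of z] right_neg [of z] that by (cases "z \<le> t") auto
        have "f x = 0" by (rule f_zero_at_maximum [of x s]) (use xy st tb le' in auto)
        moreover have "f y = 0" by (rule f_zero_at_maximum [of y s]) (use xy st tb le' in auto)
        ultimately show ?thesis using xy st by (intro no_interior_max_arc k) auto
      qed
    qed (use st that in auto)
  qed
  have "piecewise (const_sign p) a m" by (rule piecewise_snoc [OF 1]) (use m in auto)
  hence "piecewise (const_sign p) a t" by (rule piecewise_snoc) (use m in auto)
  thus ?thesis by (rule piecewise_snoc) (use 3 st in auto)
qed

lemma pieces:
  "piecewise (\<lambda>s t. structure_piece \<alpha> \<beta> \<epsilon> q r d s t \<or> max_slope_piece \<xi> d s t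
                    \<or> rest_piece \<alpha> \<beta> \<epsilon> q r b d s t) a b"
proof (rule piecewise_mono [OF costate_sign_pieces])
  fix s t assume st: "a \<le> s" "s < t" "t \<le> b" and "const_sign p s t"
  then consider "\<forall>x\<in>{s<..<t}. p x < 0" | "\<forall>x\<in>{s<..<t}. p x > 0" | "\<forall>x\<in>{s<..<t}. p x = 0"
    unfolding const_sign_def by blast
  thus "structure_piece \<alpha> \<beta> \<epsilon> q r d s t \<or> max_slope_piece \<xi> d s t \<or> rest_piece \<alpha> \<beta> \<epsilon> q r b d s t"
  proof cases
    case 1
    thus ?thesis using negative_arc [OF st] by simp
  next
    case 2
    thus ?thesis using positive_arc [OF st] by simp
  next
    case 3
    thus ?thesis using zero_arc [OF st] by simp
  qed
qed

end

section \<open>Conclusions for optimal profiles\<close>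

context drawdown
begin

text \<open>A positive costate prescribes u = 0, whence the third kind of piece, which is
  incompatible with strict growth of d. For \<xi> = 1 the maximal slope is itself 0, so d coincides
  with \<open>dmax\<close>.\<close>

lemma area_optimal_pieces:
  assumes opt: "optimal (admissible_area \<xi> a d0 K) J b d"
  shows "\<exists>r>0.
           piecewise (\<lambda>s t. structure_piece \<alpha> \<beta> \<epsilon> q r d s t \<or> max_slope_piece \<xi> d s t
                            \<or> rest_piece \<alpha> \<beta> \<epsilon> q r b d s t) a b
           \<and> (\<xi> = 1 \<or> strict_mono_on {a..b} d \<longrightarrow>
                piecewise (\<lambda>s t. structure_piece \<alpha> \<beta> \<epsilon> q r d s t \<or> max_slope_piece \<xi> d s t) a b)"
proof -
  have d: "adm b d" and K: "integral {a..b} d \<le> K" and fin: "J b d < \<infinity>"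
    and min: "\<And>b' e. adm b' e \<Longrightarrow> integral {a..b'} e \<le> K \<Longrightarrow> J b d \<le> J b' e"
    using opt unfolding optimal_def admissible_area_def by blast+
  have le: "a \<le> b" using admissible_le [OF d] .
  show ?thesis
  proof (cases "a = b \<or> d b = dmax b")
    case True
    have "max_slope_piece \<xi> d a b" if "a < b"
    proof -
      have "d x = d0 + (1 - \<xi>) * (x - a)" if "x \<in> {a..b}" for x
        using adm_eq_dmax [OF d _ that] True \<open>a < b\<close> by (simp add: max_slope_profile_def)
      thus ?thesis using admissible_start [OF d] unfolding max_slope_piece_def by simp
    qed
    hence "piecewise (\<lambda>s t. structure_piece \<alpha> \<beta> \<epsilon> q 1 d s t \<or> max_slope_piece \<xi> d s t) a b"
      using le by (intro piecewise_single) auto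
    moreover from this have "piecewise (\<lambda>s t. structure_piece \<alpha> \<beta> \<epsilon> q 1 d s t \<or> max_slope_piece \<xi> d s t
        \<or> rest_piece \<alpha> \<beta> \<epsilon> q 1 b d s t) a b"
      by (rule piecewise_mono) blast
    \<comment> \<open>Any positive r serves when at most one piece of maximal slope occurs.\<close>
    ultimately show ?thesis by (intro exI [of _ 1]) simp
  next
    case False
    hence ab: "a < b" and nmax: "d b \<noteq> dmax b" using le by auto
    have db: "d0 \<le> d b" "d b < dmax b"
      using adm_bounds [OF d le order_refl] nmax by auto
    hence "d0 < d0 + (1 - \<xi>) * (b - a)" by (simp add: max_slope_profile_def)
    hence xi1: "\<xi> < 1" using ab by (simp add: zero_less_mult_iff)
    have d0: "d0 > 0" using cost_finite_start [OF d ab fin] .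
    have nc: "d b > d0"
    proof (rule ccontr)
      assume "\<not> d b > d0"
      hence "d b = d0" using db by simp
      then obtain b' e where "adm b' e" "integral {a..b'} e \<le> integral {a..b} d" "J b' e < J b d"
        using constant_improvable [OF d0 xi1 ab d] by blast
      thus False using min [of b' e] K by (meson leD order_trans)
    qed
    obtain r where r: "r \<ge> 0" "\<And>e. adm b e \<Longrightarrow> variation b d e \<le> r * integral {a..b} (\<lambda>t. e t - d t)"
      using multiplier [OF ab d0 d K nc min] by blast
    interpret E: extremal \<alpha> \<beta> \<epsilon> q \<xi> a d0 b r d
      by unfold_locales (use ab d0 d r in auto)
    \<comment> \<open>With r = 0 area would carry no price, yet \<open>dmax\<close> has positive
      variation because it ends strictly above d.\<close>
    have "r \<noteq> 0"
    proof
      assume "r = 0"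
      hence "variation b d dmax \<le> 0" using r(2) [OF adm_dmax [OF le]] by simp
      moreover have "integral {a..b} (\<lambda>t. d2\<nu> t (t - d t) * (dmax t - d t)) \<ge> 0"
      proof (rule Henstock_Kurzweil_Integration.integral_nonneg)
        show "(\<lambda>t. d2\<nu> t (t - d t) * (dmax t - d t)) integrable_on {a..b}"
          by (rule integrable_variation(1) [OF d0 d adm_dmax [OF le]])
        show "0 \<le> d2\<nu> t (t - d t) * (dmax t - d t)" if "t \<in> {a..b}" for t
          using E.path [OF that] adm_bounds(2) [OF d, of t] that
          by (intro mult_nonneg_nonneg less_imp_le [OF d2_nu_pos]) auto
      qed
      moreover have "terminal_weight b d * (dmax b - d b) > 0"
        using terminal_weight_pos [OF d0 d] db by simp
      ultimately show False by (simp add: variation_def)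
    qed
    hence rpos: "r > 0" using r(1) by simp
    have "piecewise (\<lambda>s t. structure_piece \<alpha> \<beta> \<epsilon> q r d s t \<or> max_slope_piece \<xi> d s t) a b"
      if "\<xi> = 1 \<or> strict_mono_on {a..b} d"
    proof (rule piecewise_mono [OF E.pieces])
      fix s t assume st: "a \<le> s" "s < t" "t \<le> b"
        and piece: "structure_piece \<alpha> \<beta> \<epsilon> q r d s t \<or> max_slope_piece \<xi> d s t \<or> rest_piece \<alpha> \<beta> \<epsilon> q r b d s t"
      have "d s < d t"
        using that xi1 st by (intro strict_mono_onD [of "{a..b}" d]) auto
      moreover have "d t = d s" if "rest_piece \<alpha> \<beta> \<epsilon> q r b d s t"
        using that st(2) unfolding rest_piece_def by (meson atLeastAtMost_iff less_imp_le order_refl)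
      ultimately have "\<not> rest_piece \<alpha> \<beta> \<epsilon> q r b d s t" by auto
      thus "structure_piece \<alpha> \<beta> \<epsilon> q r d s t \<or> max_slope_piece \<xi> d s t" using piece by blast
    qed
    thus ?thesis using E.pieces rpos by blast
  qed
qed

text \<open>All admissible profiles lie below \<open>dmax\<close>, so \<open>cost_mono\<close>
  applies; equal finite costs force equal end values, and \<open>adm_eq_dmax\<close> carries the
  equality back to a.\<close>

lemma max_slope_best:
  assumes d: "adm b d"
  shows "J b dmax \<le> J b d"
    and "J b d = J b dmax \<Longrightarrow> J b d < \<infinity> \<Longrightarrow> t \<in> {a..b} \<Longrightarrow> d t = dmax t"
proof -
  note le = admissible_le [OF d]
  have below: "d t \<le> dmax t" if "t \<in> {a..b}" for t
    using adm_bounds(2) [OF d] that by simp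
  show "J b dmax \<le> J b d" by (rule cost_mono(1) [OF d adm_dmax [OF le] below])
  assume eq: "J b d = J b dmax" and fin: "J b d < \<infinity>" and t: "t \<in> {a..b}"
  have "d b = dmax b" by (rule cost_mono(2) [OF d adm_dmax [OF le] below eq [symmetric] fin])
  thus "d t = dmax t" by (rule adm_eq_dmax [OF d _ t])
qed

end

theorem lemma18:
  fixes \<alpha> \<beta> \<epsilon> q \<xi> a d0 :: real
  assumes "\<alpha> > 0" "\<beta> > 0" "\<epsilon> > 0" "q > 0" "0 \<le> \<xi>" "\<xi> \<le> 1"
    and "a \<ge> 0" "d0 \<ge> 0" "\<alpha> * (a - d0) + \<beta> > 0"
  shows
    "\<comment> \<open>(1) no area restriction\<close>
     (\<forall>x \<delta>. 0 < \<delta> \<and> \<alpha> * (x - \<delta>) + \<beta> > 0 \<longrightarrow> d2_nu \<alpha> \<beta> \<epsilon> q x (x - \<delta>) \<noteq> 0)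
   \<and> (\<forall>b\<ge>a. admissible \<xi> a d0 b (max_slope_profile \<xi> a d0))
   \<and> (\<forall>b d. admissible \<xi> a d0 b d \<longrightarrow>
        cost \<alpha> \<beta> \<epsilon> q a b (max_slope_profile \<xi> a d0) \<le> cost \<alpha> \<beta> \<epsilon> q a b d
        \<and> (cost \<alpha> \<beta> \<epsilon> q a b d = cost \<alpha> \<beta> \<epsilon> q a b (max_slope_profile \<xi> a d0)
             \<and> cost \<alpha> \<beta> \<epsilon> q a b d < \<infinity>
           \<longrightarrow> (\<forall>t\<in>{a..b}. d t = max_slope_profile \<xi> a d0 t)))
   \<and> (\<forall>b d. optimal (admissible \<xi> a d0) (cost \<alpha> \<beta> \<epsilon> q a) b d \<longrightarrow>
        (\<forall>t\<in>{a..b}. d t = max_slope_profile \<xi> a d0 t))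
     \<comment> \<open>(2) area restriction\<close>
   \<and> (\<forall>r\<ge>0. \<forall>x \<delta>. 0 < \<delta> \<and> \<alpha> * (x - \<delta>) + \<beta> > 0 \<longrightarrow>
        (d2_nu \<alpha> \<beta> \<epsilon> q x (x - \<delta>) = r
           \<longleftrightarrow> structure_eq \<alpha> \<beta> \<epsilon> q r x (log_ratio \<alpha> \<beta> x \<delta>))
        \<and> \<delta> = (x + \<beta> / \<alpha>) * (1 - exp (- log_ratio \<alpha> \<beta> x \<delta>)))
   \<and> (\<forall>K>0. \<forall>b d. optimal (admissible_area \<xi> a d0 K) (cost \<alpha> \<beta> \<epsilon> q a) b d \<longrightarrow>
        (\<exists>r>0.
           piecewise (\<lambda>s t. structure_piece \<alpha> \<beta> \<epsilon> q r d s t \<or> max_slope_piece \<xi> d s t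
                            \<or> rest_piece \<alpha> \<beta> \<epsilon> q r b d s t) a b
           \<and> (\<xi> = 1 \<or> strict_mono_on {a..b} d \<longrightarrow>
                piecewise (\<lambda>s t. structure_piece \<alpha> \<beta> \<epsilon> q r d s t \<or> max_slope_piece \<xi> d s t) a b)))"
proof -
  interpret drawdown \<alpha> \<beta> \<epsilon> q \<xi> a d0
    by unfold_locales (use assms in auto)
  show ?thesis
  proof (intro conjI allI impI ballI)
    fix x \<delta> assume "0 < \<delta> \<and> \<alpha> * (x - \<delta>) + \<beta> > 0"
    thus "d2_nu \<alpha> \<beta> \<epsilon> q x (x - \<delta>) \<noteq> 0"
      using d2_nu_pos [of "x - \<delta>" x] shift_pos_iff by force
  next
    fix b d t assume opt: "optimal (admissible \<xi> a d0) (cost \<alpha> \<beta> \<epsilon> q a) b d" and t: "t \<in> {a..b}"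
    hence d: "adm b d" "J b d < \<infinity>" "J b d \<le> J b dmax"
      using adm_dmax [of b] unfolding optimal_def by auto
    have "J b d = J b dmax" by (rule antisym [OF d(3) max_slope_best(1) [OF d(1)]])
    thus "d t = max_slope_profile \<xi> a d0 t" by (rule max_slope_best(2) [OF d(1) _ d(2) t])
  next
    fix r x \<delta> :: real assume "0 \<le> r" "0 < \<delta> \<and> \<alpha> * (x - \<delta>) + \<beta> > 0"
    thus "d2_nu \<alpha> \<beta> \<epsilon> q x (x - \<delta>) = r \<longleftrightarrow> structure_eq \<alpha> \<beta> \<epsilon> q r x (log_ratio \<alpha> \<beta> x \<delta>)"
      using structure_eq_iff shift_pos_iff by blast
  next
    fix r x \<delta> :: real assume "0 < \<delta> \<and> \<alpha> * (x - \<delta>) + \<beta> > 0"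
    thus "\<delta> = (x + \<beta> / \<alpha>) * (1 - exp (- log_ratio \<alpha> \<beta> x \<delta>))"
      using log_ratio_profile(2) shift_pos_iff by blast
  next
    fix b assume "a \<le> b"
    thus "admissible \<xi> a d0 b (max_slope_profile \<xi> a d0)" by (rule adm_dmax)
  next
    fix b d assume "admissible \<xi> a d0 b d"
    thus "cost \<alpha> \<beta> \<epsilon> q a b (max_slope_profile \<xi> a d0) \<le> cost \<alpha> \<beta> \<epsilon> q a b d"
      by (rule max_slope_best(1))
  next
    fix b d t
    assume "admissible \<xi> a d0 b d" "t \<in> {a..b}"
      and "cost \<alpha> \<beta> \<epsilon> q a b d = cost \<alpha> \<beta> \<epsilon> q a b (max_slope_profile \<xi> a d0)
             \<and> cost \<alpha> \<beta> \<epsilon> q a b d < \<infinity>"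
    thus "d t = max_slope_profile \<xi> a d0 t" using max_slope_best(2) by blast
  next
    fix K b d assume "optimal (admissible_area \<xi> a d0 K) (cost \<alpha> \<beta> \<epsilon> q a) b d"
    thus "\<exists>r>0.
           piecewise (\<lambda>s t. structure_piece \<alpha> \<beta> \<epsilon> q r d s t \<or> max_slope_piece \<xi> d s t
                            \<or> rest_piece \<alpha> \<beta> \<epsilon> q r b d s t) a b
           \<and> (\<xi> = 1 \<or> strict_mono_on {a..b} d \<longrightarrow>
                piecewise (\<lambda>s t. structure_piece \<alpha> \<beta> \<epsilon> q r d s t \<or> max_slope_piece \<xi> d s t) a b)"
      by (rule area_optimal_pieces)
  qed
qed

end
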